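(* Let $K$ be a semitopological semihypergroup and $f\in AP(K)$. Then the map $\Phi:\mathcal{B}_1\times\mathcal{B}_1\to\mathbb{C}$ given by $\Phi(\mu,\nu):=\mu(T_\nu f)$ is continuous with respect to the topology $\sigma(\mathcal{B}_1,AP(K))\times\sigma(\mathcal{B}_1,AP(K))$. Moreover, for any $\mu,\nu\in AP(K)^*$ we have $\mu(T_\nu f)=\nu(U_\mu f)$.
   Context: All topologies are Hausdorff. For a locally compact Hausdorff space $X$: $M(X)$ is the space of regular complex Borel measures on $X$; $M^+(X)$ is the set of finite non-negative regular Borel measures, with the cone topology (the weakest topology making $\mu\mapsto\int_X f\,d\mu$ continuous for every $f\in C_c^+(X)\cup\{1_X\}$, where $C_c^+(X)$ is the set of non-negative compactly supported continuous functions and $1_X$ is the constant function $1$); $\mathfrak{C}(X)$ is the set of compact subsets of $X$ with the Michael topology, generated by the sub-basis of sets $\{C\in\mathfrak{C}(X): C\cap U\neq\emptyset,\ C\subset V\}$ for $U,V$ open in $X$; $p_x$ is the point mass at $x$. A semitopological semihypergroup is a pair $(K,* )$ such that: (A1) $K$ is a locally compact Hausdorff space and $*$ is a binary operation making $M(K)$ an associative algebra; (A2) $*$ sends $M^+(K)\times M^+(K)$ into $M^+(K)$ and for each $\omega\in M^+(K)$ both maps $\mu\mapsto\omega*\mu$ and $\mu\mapsto\mu*\omega$ from $M^+(K)$ to $M^+(K)$ are continuous; (A3) for all $x,y\in K$, $p_x*p_y$ is a probability measure with compact support; (A4) the map $(x,y)\mapsto \mathrm{supp}(p_x*p_y)$,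 $K\times K\to\mathfrak{C}(K)$, is continuous. $C(K)$ is the space of bounded continuous complex-valued functions on $K$ with the supremum norm. For measurable $f$ on $K$ and $x,y\in K$, $L_xf(y)=R_yf(x)=f(x*y):=\int_K f\,d(p_x*p_y)$. $AP_r(K)$ (resp. $AP_l(K)$) is the set of $f\in C(K)$ such that $\{R_xf:x\in K\}$ (resp. $\{L_xf:x\in K\}$) is relatively compact in $C(K)$ in the norm topology; $AP(K)$ denotes the common space $AP_l(K)=AP_r(K)$, with the supremum norm. It is invariant under all $L_x$ and $R_x$. For $\mu\in AP(K)^*$ and $f\in AP(K)$, $T_\mu f(x):=\mu(L_xf)$ and $U_\mu f(x):=\mu(R_xf)$ for $x\in K$; $T_\mu f$ and $U_\mu f$ belong to $AP(K)$. $\mathcal{B}_1$ is the closed unit ball of $AP(K)^*$ and $\sigma(\mathcal{B}_1,AP(K))$ is the weak$^*$ topology on it (pointwise convergence on $AP(K)$). *)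

theory Defs
  imports "HOL-Probability.Probability_Measure"
begin

section \<open>Complex and positive Borel measures\<close>

text \<open>
  The library has no complex measures. A complex Borel measure is a countably additive complex
  set function on the Borel sets; since HOL functions are total it is normalised to be \<open>0\<close> on
  non-Borel sets, so that equality of measures is equality of functions.
\<close>

definition complex_borel_measure :: "('k::topological_space set \<Rightarrow> complex) \<Rightarrow> bool" where
  "complex_borel_measure \<mu> \<longleftrightarrow>
     (\<forall>A. A \<notin> sets borel \<longrightarrow> \<mu> A = 0) \<and>
     (\<forall>E :: nat \<Rightarrow> 'k set. range E \<subseteq> sets borel \<longrightarrow> disjoint_family E \<longrightarrow>
        (\<lambda>n. \<mu> (E n)) sums \<mu> (\<Union>n. E n))"

definition total_variation :: "('k::topological_space set \<Rightarrow> complex) \<Rightarrow> 'k set \<Rightarrow> ennreal" where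
  "total_variation \<mu> A =
     (SUP E \<in> {E :: nat \<Rightarrow> 'k set. range E \<subseteq> sets borel \<and> disjoint_family E \<and> (\<Union>n. E n) = A}.
        \<Sum>n. ennreal (cmod (\<mu> (E n))))"

definition regular_borel_measure :: "('k::topological_space set \<Rightarrow> complex) \<Rightarrow> bool" where
  "regular_borel_measure \<mu> \<longleftrightarrow>
     (\<forall>A \<in> sets borel.
        total_variation \<mu> A = (INF U \<in> {U. open U \<and> A \<subseteq> U}. total_variation \<mu> U) \<and>
        total_variation \<mu> A = (SUP C \<in> {C. compact C \<and> C \<subseteq> A}. total_variation \<mu> C))"

definition M_space :: "('k::topological_space set \<Rightarrow> complex) set" where
  "M_space = {\<mu>. complex_borel_measure \<mu> \<and> regular_borel_measure \<mu>}"

definition M_plus :: "('k::topological_space set \<Rightarrow> complex) set" where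
  "M_plus = {\<mu> \<in> M_space. \<forall>A. \<mu> A \<in> \<real>\<^sub>\<ge>\<^sub>0}"

text \<open>The library measure belonging to an element of \<open>M_plus\<close>; it provides the integral.\<close>

definition as_measure :: "('k::topological_space set \<Rightarrow> complex) \<Rightarrow> 'k measure" where
  "as_measure \<mu> = measure_of UNIV (sets borel) (\<lambda>A. ennreal (Re (\<mu> A)))"

definition point_mass :: "'k::topological_space \<Rightarrow> 'k set \<Rightarrow> complex" where
  "point_mass x A = (if A \<in> sets borel \<and> x \<in> A then 1 else 0)"

definition supp :: "('k::topological_space set \<Rightarrow> complex) \<Rightarrow> 'k set" where
  "supp \<mu> = {x. \<forall>U. open U \<and> x \<in> U \<longrightarrow> total_variation \<mu> U > 0}"

definition Cc_plus :: "('k::topological_space \<Rightarrow> real) set" where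
  "Cc_plus = {f. continuous_on UNIV f \<and> (\<forall>x. 0 \<le> f x) \<and> compact (closure {x. f x \<noteq> 0})}"

definition cone_topology :: "('k::topological_space set \<Rightarrow> complex) topology" where
  "cone_topology = topology_generated_by
     {{\<mu> \<in> M_plus. (\<integral>x. f x \<partial>as_measure \<mu>) \<in> W} | f W. f \<in> Cc_plus \<union> {\<lambda>_. 1} \<and> open W}"

text \<open>
  The carrier \<open>{C. compact C}\<close> is listed among the generators because the empty set, which is
  compact, lies in no set of the sub-basis.
\<close>

definition michael_topology :: "'k::topological_space set topology" where
  "michael_topology = topology_generated_by
     (insert {C. compact C} {{C. compact C \<and> C \<inter> U \<noteq> {} \<and> C \<subseteq> V} | U V. open U \<and> open V})"


section \<open>Semitopological semihypergroups\<close>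

type_synonym 'k convolution = "('k set \<Rightarrow> complex) \<Rightarrow> ('k set \<Rightarrow> complex) \<Rightarrow> 'k set \<Rightarrow> complex"

locale semitopological_semihypergroup =
  fixes conv :: "'k::t2_space convolution"
  assumes locally_compact: "locally_compact_space (euclidean :: 'k topology)"
    and conv_closed: "\<And>\<mu> \<nu>. \<mu> \<in> M_space \<Longrightarrow> \<nu> \<in> M_space \<Longrightarrow> conv \<mu> \<nu> \<in> M_space"
    and conv_assoc: "\<And>\<mu> \<nu> \<rho>. \<mu> \<in> M_space \<Longrightarrow> \<nu> \<in> M_space \<Longrightarrow> \<rho> \<in> M_space \<Longrightarrow>
          conv (conv \<mu> \<nu>) \<rho> = conv \<mu> (conv \<nu> \<rho>)"
    and conv_add_left: "\<And>\<mu> \<nu> \<rho>. \<mu> \<in> M_space \<Longrightarrow> \<nu> \<in> M_space \<Longrightarrow> \<rho> \<in> M_space \<Longrightarrow>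
          conv (\<lambda>A. \<mu> A + \<nu> A) \<rho> = (\<lambda>A. conv \<mu> \<rho> A + conv \<nu> \<rho> A)"
    and conv_add_right: "\<And>\<mu> \<nu> \<rho>. \<mu> \<in> M_space \<Longrightarrow> \<nu> \<in> M_space \<Longrightarrow> \<rho> \<in> M_space \<Longrightarrow>
          conv \<rho> (\<lambda>A. \<mu> A + \<nu> A) = (\<lambda>A. conv \<rho> \<mu> A + conv \<rho> \<nu> A)"
    and conv_scale_left: "\<And>c \<mu> \<nu>. \<mu> \<in> M_space \<Longrightarrow> \<nu> \<in> M_space \<Longrightarrow>
          conv (\<lambda>A. c * \<mu> A) \<nu> = (\<lambda>A. c * conv \<mu> \<nu> A)"
    and conv_scale_right: "\<And>c \<mu> \<nu>. \<mu> \<in> M_space \<Longrightarrow> \<nu> \<in> M_space \<Longrightarrow>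
          conv \<mu> (\<lambda>A. c * \<nu> A) = (\<lambda>A. c * conv \<mu> \<nu> A)"
    and conv_M_plus: "\<And>\<mu> \<nu>. \<mu> \<in> M_plus \<Longrightarrow> \<nu> \<in> M_plus \<Longrightarrow> conv \<mu> \<nu> \<in> M_plus"
    and conv_continuous_right: "\<And>\<omega>. \<omega> \<in> M_plus \<Longrightarrow>
          continuous_map cone_topology cone_topology (\<lambda>\<mu>. conv \<omega> \<mu>)"
    and conv_continuous_left: "\<And>\<omega>. \<omega> \<in> M_plus \<Longrightarrow>
          continuous_map cone_topology cone_topology (\<lambda>\<mu>. conv \<mu> \<omega>)"
    and conv_point_mass_prob: "\<And>x y.
          prob_space (as_measure (conv (point_mass x) (point_mass y)))"
    and conv_point_mass_supp: "\<And>x y. compact (supp (conv (point_mass x) (point_mass y)))"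
    and supp_continuous: "continuous_map (euclidean :: ('k \<times> 'k) topology) michael_topology
          (\<lambda>(x, y). supp (conv (point_mass x) (point_mass y)))"


section \<open>Translations and almost periodic functions\<close>

definition eval_product :: "'k::t2_space convolution \<Rightarrow> ('k \<Rightarrow> complex) \<Rightarrow> 'k \<Rightarrow> 'k \<Rightarrow> complex" where
  "eval_product conv f x y = (\<integral>z. f z \<partial>as_measure (conv (point_mass x) (point_mass y)))"

definition left_translate :: "'k::t2_space convolution \<Rightarrow> 'k \<Rightarrow> ('k \<Rightarrow> complex) \<Rightarrow> 'k \<Rightarrow> complex" where
  "left_translate conv x f = (\<lambda>y. eval_product conv f x y)"

definition right_translate :: "'k::t2_space convolution \<Rightarrow> 'k \<Rightarrow> ('k \<Rightarrow> complex) \<Rightarrow> 'k \<Rightarrow> complex" where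
  "right_translate conv y f = (\<lambda>x. eval_product conv f x y)"

text \<open>
  The space of bounded continuous functions with the supremum norm is the library type of
  bounded continuous functions; \<open>Bcontfun\<close> converts an element of the set \<open>bcontfun\<close> to it.
\<close>

definition relatively_compact_in_C :: "('k::t2_space \<Rightarrow> complex) set \<Rightarrow> bool" where
  "relatively_compact_in_C S \<longleftrightarrow> S \<subseteq> bcontfun \<and> compact (closure (Bcontfun ` S))"

definition AP_l :: "'k::t2_space convolution \<Rightarrow> ('k \<Rightarrow>\<^sub>C complex) set" where
  "AP_l conv = {f. relatively_compact_in_C (range (\<lambda>x. left_translate conv x (apply_bcontfun f)))}"

definition AP_r :: "'k::t2_space convolution \<Rightarrow> ('k \<Rightarrow>\<^sub>C complex) set" where
  "AP_r conv = {f. relatively_compact_in_C (range (\<lambda>x. right_translate conv x (apply_bcontfun f)))}"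

text \<open>
  On a semitopological semihypergroup \<open>AP_l\<close> and \<open>AP_r\<close> coincide, and the intersection is their
  common value.
\<close>

definition AP :: "'k::t2_space convolution \<Rightarrow> ('k \<Rightarrow>\<^sub>C complex) set" where
  "AP conv = AP_l conv \<inter> AP_r conv"


section \<open>The dual space and the operators it induces\<close>

definition scaleC_bcontfun :: "complex \<Rightarrow> ('k::t2_space \<Rightarrow>\<^sub>C complex) \<Rightarrow> ('k \<Rightarrow>\<^sub>C complex)" where
  "scaleC_bcontfun c f = Bcontfun (\<lambda>x. c * apply_bcontfun f x)"

text \<open>
  Bounded complex-linear functionals on \<open>AP conv\<close>. Extensionality fixes their value outside
  \<open>AP conv\<close>, so that distinct elements are distinct as functionals on \<open>AP conv\<close>.
\<close>

definition AP_dual :: "'k::t2_space convolution \<Rightarrow> (('k \<Rightarrow>\<^sub>C complex) \<Rightarrow> complex) set" where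
  "AP_dual conv = {\<mu> \<in> extensional (AP conv).
     (\<forall>f \<in> AP conv. \<forall>g \<in> AP conv. \<mu> (f + g) = \<mu> f + \<mu> g) \<and>
     (\<forall>c. \<forall>f \<in> AP conv. \<mu> (scaleC_bcontfun c f) = c * \<mu> f) \<and>
     (\<exists>B. \<forall>f \<in> AP conv. cmod (\<mu> f) \<le> B * norm f)}"

definition dual_norm :: "'k::t2_space convolution \<Rightarrow> (('k \<Rightarrow>\<^sub>C complex) \<Rightarrow> complex) \<Rightarrow> real" where
  "dual_norm conv \<mu> = (SUP f \<in> {f \<in> AP conv. norm f \<le> 1}. cmod (\<mu> f))"

definition dual_ball :: "'k::t2_space convolution \<Rightarrow> (('k \<Rightarrow>\<^sub>C complex) \<Rightarrow> complex) set" where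
  "dual_ball conv = {\<mu> \<in> AP_dual conv. dual_norm conv \<mu> \<le> 1}"

text \<open>The weak* topology on the ball: pointwise convergence on \<open>AP conv\<close>.\<close>

definition weak_star_ball ::
    "'k::t2_space convolution \<Rightarrow> (('k \<Rightarrow>\<^sub>C complex) \<Rightarrow> complex) topology" where
  "weak_star_ball conv =
     subtopology (product_topology (\<lambda>_. euclidean) (AP conv)) (dual_ball conv)"

text \<open>
  \<open>T_op conv \<mu> f\<close> and \<open>U_op conv \<mu> f\<close> are meant for \<open>f \<in> AP conv\<close> and \<open>\<mu> \<in> AP_dual conv\<close>. There
  all functions to which \<open>Bcontfun\<close> is applied are bounded and continuous, and translates and
  results lie in \<open>AP conv\<close> again.
\<close>

definition T_op ::
    "'k::t2_space convolution \<Rightarrow> (('k \<Rightarrow>\<^sub>C complex) \<Rightarrow> complex) \<Rightarrow> ('k \<Rightarrow>\<^sub>C complex) \<Rightarrow> ('k \<Rightarrow>\<^sub>C complex)" where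
  "T_op conv \<mu> f =
     Bcontfun (\<lambda>x. \<mu> (Bcontfun (left_translate conv x (apply_bcontfun f))))"

definition U_op ::
    "'k::t2_space convolution \<Rightarrow> (('k \<Rightarrow>\<^sub>C complex) \<Rightarrow> complex) \<Rightarrow> ('k \<Rightarrow>\<^sub>C complex) \<Rightarrow> ('k \<Rightarrow>\<^sub>C complex)" where
  "U_op conv \<mu> f =
     Bcontfun (\<lambda>x. \<mu> (Bcontfun (right_translate conv x (apply_bcontfun f))))"

end

theory Submission
  imports Defs "HOL-Probability.Giry_Monad"
begin

text \<open>
  For \<open>f\<close> almost periodic consider the kernel \<open>F (x, y) = f (x * y)\<close>. Its rows are the left
  translates of \<open>f\<close>, its columns the right translates, and almost periodicity says that the rows
  (equivalently the columns, \<open>totally_bounded_family_transpose\<close>) form a totally bounded set in the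
  supremum norm. Such a kernel is, up to a uniformly small error, a finite sum
  \<open>\<Sum>\<^sub>i \<phi>\<^sub>i x * F (x\<^sub>i, y)\<close> with a partition of unity \<open>\<phi>\<^sub>i\<close> (\<open>finite_rank_approximation\<close>).

  The identity \<open>\<mu> (T \<nu> f) = \<nu> (U \<mu> f)\<close> says that \<open>\<mu>\<close> acting on \<open>x\<close> and \<open>\<nu>\<close> acting on \<open>y\<close> may be
  applied to \<open>F\<close> in either order. For finite sums of products this is clear, and the general case
  follows by approximation (\<open>functional_Fubini\<close>). As the \<open>\<phi>\<^sub>i\<close> need not be almost periodic, \<open>\<mu>\<close> and
  \<open>\<nu>\<close> are first extended to all bounded continuous functions by the Hahn-Banach theorem, which
  is obtained from minimal sublinear functionals.

  That \<open>T \<nu> f\<close> and \<open>U \<mu> f\<close> are almost periodic rests on the same interchange with integration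
  against \<open>p\<^sub>x * p\<^sub>y\<close> as one of the functionals. It also needs the formula
  \<open>\<integral> f d(p\<^sub>x * \<mu>) = \<integral> f (x * w) d\<mu>(w)\<close> and its mirror image, which turn associativity of
  convolution into relations between translations. Both sides are linear in \<open>\<mu>\<close> and agree for point
  masses; continuity of convolution in the cone topology extends this from discrete measures to
  regular ones (\<open>integral_image_eq_iterated\<close>).

  Joint continuity comes from compactness: functionals in the unit ball are equicontinuous, so
  weak* convergence of \<open>\<nu>\<close> is uniform on the totally bounded set of left translates of \<open>f\<close>. Hence
  \<open>T \<nu> f\<close> depends on \<open>\<nu>\<close> continuously in norm, and pairing with a bounded weak* convergent \<open>\<mu>\<close> is
  continuous.
\<close>

section \<open>The Hahn-Banach theorem\<close>


text \<open>
  Homogeneity is asked for as an inequality only; applied to the factor and to its inverse it gives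
  equality, and the value \<open>0\<close> at the origin follows.
\<close>

definition sublinear :: "('v::real_vector \<Rightarrow> real) \<Rightarrow> bool" where
  "sublinear p \<longleftrightarrow> (\<forall>x y. p (x + y) \<le> p x + p y) \<and> (\<forall>c>0. \<forall>x. p (c *\<^sub>R x) \<le> c * p x)"

lemma sublinear_add: "sublinear p \<Longrightarrow> p (x + y) \<le> p x + p y"
  by (simp add: sublinear_def)

lemma sublinear_scale:
  assumes "sublinear p" "0 < c"
  shows "p (c *\<^sub>R x) = c * p x"
proof (rule antisym)
  show "p (c *\<^sub>R x) \<le> c * p x" using assms by (simp add: sublinear_def)
  have "p (inverse c *\<^sub>R (c *\<^sub>R x)) \<le> inverse c * p (c *\<^sub>R x)"
    using assms unfolding sublinear_def by (meson inverse_positive_iff_positive)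
  then show "c * p x \<le> p (c *\<^sub>R x)" using assms(2) by (simp add: field_simps)
qed

lemma sublinear_zero: "sublinear p \<Longrightarrow> p 0 = 0"
  using sublinear_scale[of p 2 0] by simp

lemma sublinear_uminus: "sublinear p \<Longrightarrow> - p (- x) \<le> p x"
  using sublinear_add[of p x "- x"] sublinear_zero[of p] by simp

text \<open>
  The values are bounded below because \<open>- p (- x) \<le> - q (- x) \<le> q x\<close> for every member \<open>q\<close>. For
  subadditivity two members are compared through the smaller of them, which is where the chain
  condition enters.
\<close>

lemma sublinear_INF_chain:
  fixes C :: "('v::real_vector \<Rightarrow> real) set"
  assumes "C \<noteq> {}" and sub: "\<And>q. q \<in> C \<Longrightarrow> sublinear q" and le: "\<And>q. q \<in> C \<Longrightarrow> q \<le> p"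
    and chain: "\<And>q r. q \<in> C \<Longrightarrow> r \<in> C \<Longrightarrow> q \<le> r \<or> r \<le> q"
  shows "sublinear (\<lambda>x. INF q\<in>C. q x)" and "\<And>q x. q \<in> C \<Longrightarrow> (INF q\<in>C. q x) \<le> q x"
proof -
  have bdd: "bdd_below ((\<lambda>q. q x) ` C)" for x
  proof (rule bdd_belowI2)
    fix q assume q: "q \<in> C"
    show "- p (- x) \<le> q x"
      using sublinear_uminus[OF sub[OF q], of x] le_funD[OF le[OF q], of "- x"] by linarith
  qed
  show lower: "(INF q\<in>C. q x) \<le> q x" if "q \<in> C" for q x
    using bdd that by (intro cINF_lower)
  let ?s = "\<lambda>x. INF q\<in>C. q x"
  have add: "?s (x + y) \<le> ?s x + ?s y" for x y
  proof -
    have *: "?s (x + y) \<le> q x + r y" if qr: "q \<in> C" "r \<in> C" for q r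
    proof -
      obtain m where m: "m \<in> C" "m \<le> q" "m \<le> r"
        using chain[OF qr] qr by blast
      have "?s (x + y) \<le> m x + m y"
        using lower[OF m(1), of "x + y"] sublinear_add[OF sub[OF m(1)], of x y] by linarith
      also have "\<dots> \<le> q x + r y" using m by (intro add_mono) (auto simp: le_fun_def)
      finally show ?thesis .
    qed
    have "?s (x + y) - r y \<le> ?s x" if "r \<in> C" for r
      by (rule cINF_greatest[OF \<open>C \<noteq> {}\<close>]) (use *[OF _ that] in \<open>simp add: algebra_simps\<close>)
    then have "?s (x + y) - ?s x \<le> ?s y"
      by (intro cINF_greatest[OF \<open>C \<noteq> {}\<close>]) (simp add: algebra_simps)
    then show ?thesis by simp
  qed
  have scale: "?s (c *\<^sub>R x) \<le> c * ?s x" if c: "c > 0" for c x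
  proof -
    have "?s (c *\<^sub>R x) / c \<le> q x" if "q \<in> C" for q
      using lower[OF that, of "c *\<^sub>R x"] sublinear_scale[OF sub[OF that] c, of x] c
      by (simp add: field_simps)
    then have "?s (c *\<^sub>R x) / c \<le> ?s x" by (intro cINF_greatest[OF \<open>C \<noteq> {}\<close>])
    then show ?thesis using c by (simp add: field_simps)
  qed
  show "sublinear ?s" unfolding sublinear_def using add scale by blast
qed

lemma minimal_sublinear_exists:
  fixes p :: "'v::real_vector \<Rightarrow> real"
  assumes "sublinear p"
  obtains q where "sublinear q" "q \<le> p" "\<And>r. sublinear r \<Longrightarrow> r \<le> q \<Longrightarrow> r = q"
proof -
  define A where "A = {q. sublinear q \<and> q \<le> p}"
  have po: "partial_order_on A (relation_of (\<lambda>q r. r \<le> q) A)"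
    by (rule partial_order_on_relation_ofI) auto
  have "\<exists>u\<in>A. \<forall>q\<in>C. u \<le> q" if C: "C \<in> Chains (relation_of (\<lambda>q r. r \<le> q) A)" for C
  proof (cases "C = {}")
    case True
    then show ?thesis using assms by (auto simp: A_def)
  next
    case False
    have CA: "q \<in> A" if "q \<in> C" for q using C that by (auto simp: Chains_def relation_of_def)
    have ch: "q \<le> r \<or> r \<le> q" if "q \<in> C" "r \<in> C" for q r
      using C that by (auto simp: Chains_def relation_of_def)
    have sub: "sublinear q" and le: "q \<le> p" if "q \<in> C" for q
      using CA[OF that] by (auto simp: A_def)
    let ?s = "\<lambda>x. INF q\<in>C. q x"
    have 1: "sublinear ?s" and 2: "\<And>q x. q \<in> C \<Longrightarrow> ?s x \<le> q x"
      using sublinear_INF_chain[OF False sub le ch] by blast+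
    obtain q0 where "q0 \<in> C" using False by blast
    then have "?s \<le> p" using 2 le_funD[OF le] by (intro le_funI) (rule order_trans)
    then have "?s \<in> A" using 1 by (simp add: A_def)
    moreover have "\<forall>q\<in>C. ?s \<le> q" using 2 by (simp add: le_fun_def)
    ultimately show ?thesis by blast
  qed
  from predicate_Zorn[OF po this] obtain q where q: "q \<in> A" "\<forall>r\<in>A. r \<le> q \<longrightarrow> r = q"
    by auto
  show ?thesis
  proof (rule that[of q])
    show "sublinear q" "q \<le> p" using q(1) by (auto simp: A_def)
    show "r = q" if "sublinear r" "r \<le> q" for r
      using q that unfolding A_def by (metis (mono_tags, lifting) mem_Collect_eq order_trans)
  qed
qed

text \<open>
  For fixed \<open>y\<close>, lowering \<open>q\<close> to \<open>x \<mapsto> inf {q (x + t y) - t q y | t \<ge> 0}\<close> again gives a sublinear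
  functional, so by minimality nothing is lowered. Taking \<open>t = 1\<close> shows that \<open>q\<close> is superadditive.
\<close>

lemma minimal_sublinear_imp_linear:
  fixes q :: "'v::real_vector \<Rightarrow> real"
  assumes sub: "sublinear q" and min: "\<And>r. sublinear r \<Longrightarrow> r \<le> q \<Longrightarrow> r = q"
  shows "linear q"
proof -
  have superadd: "q x + q y \<le> q (x + y)" for x y
  proof -
    define r where "r = (\<lambda>x. INF t\<in>{0::real..}. q (x + t *\<^sub>R y) - t * q y)"
    have pos: "q (t *\<^sub>R y) = t * q y" if "0 \<le> t" for t
      using sublinear_scale[OF sub, of t y] sublinear_zero[OF sub] that by (cases "t = 0") auto
    have bdd: "bdd_below ((\<lambda>t. q (x + t *\<^sub>R y) - t * q y) ` {0..})" for x
    proof (rule bdd_belowI2)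
      fix t :: real assume "t \<in> {0..}"
      then show "- q (- x) \<le> q (x + t *\<^sub>R y) - t * q y"
        using sublinear_add[OF sub, of "x + t *\<^sub>R y" "- x"] pos[of t] by simp
    qed
    have lower: "r x \<le> q (x + t *\<^sub>R y) - t * q y" if "0 \<le> t" for x t
      unfolding r_def by (rule cINF_lower[OF bdd]) (use that in auto)
    have "sublinear r"
      unfolding sublinear_def
    proof (intro conjI allI impI)
      fix x x'
      have *: "r (x + x') \<le> (q (x + t *\<^sub>R y) - t * q y) + (q (x' + s *\<^sub>R y) - s * q y)"
        if "0 \<le> t" "0 \<le> s" for t s
      proof -
        have "r (x + x') \<le> q ((x + x') + (t + s) *\<^sub>R y) - (t + s) * q y"
          by (rule lower) (use that in auto)
        also have "(x + x') + (t + s) *\<^sub>R y = (x + t *\<^sub>R y) + (x' + s *\<^sub>R y)"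
          by (simp add: algebra_simps)
        also have "q \<dots> \<le> q (x + t *\<^sub>R y) + q (x' + s *\<^sub>R y)" by (rule sublinear_add[OF sub])
        finally show ?thesis by (simp add: algebra_simps)
      qed
      have "r (x + x') - (q (x' + s *\<^sub>R y) - s * q y) \<le> r x" if "0 \<le> s" for s
        unfolding r_def[THEN fun_cong, of x]
        by (rule cINF_greatest) (use *[OF _ that] in \<open>auto simp: algebra_simps\<close>)
      then have "r (x + x') - r x \<le> q (x' + s *\<^sub>R y) - s * q y" if "0 \<le> s" for s
        using that by (simp add: algebra_simps)
      then have "r (x + x') - r x \<le> r x'"
        unfolding r_def[THEN fun_cong, of x'] by (intro cINF_greatest) auto
      then show "r (x + x') \<le> r x + r x'" by simp
    next
      fix c :: real and x assume c: "0 < c"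
      have "r (c *\<^sub>R x) / c \<le> q (x + t *\<^sub>R y) - t * q y" if "0 \<le> t" for t
      proof -
        have "r (c *\<^sub>R x) \<le> q (c *\<^sub>R x + (c * t) *\<^sub>R y) - (c * t) * q y"
          by (rule lower) (use that c in auto)
        also have "c *\<^sub>R x + (c * t) *\<^sub>R y = c *\<^sub>R (x + t *\<^sub>R y)" by (simp add: algebra_simps)
        also have "q \<dots> = c * q (x + t *\<^sub>R y)" by (rule sublinear_scale[OF sub c])
        finally show ?thesis using c by (simp add: field_simps)
      qed
      then have "r (c *\<^sub>R x) / c \<le> r x"
        unfolding r_def[THEN fun_cong, of x] by (intro cINF_greatest) auto
      then show "r (c *\<^sub>R x) \<le> c * r x" using c by (simp add: field_simps)
    qed
    moreover have "r \<le> q" using lower[of 0] by (simp add: le_fun_def)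
    ultimately have "r = q" by (rule min)
    then show ?thesis using lower[of 1 x] by simp
  qed
  have add: "q (x + y) = q x + q y" for x y
    using superadd[of x y] sublinear_add[OF sub, of x y] by simp
  have neg: "q (- x) = - q x" for x
    using add[of x "- x"] sublinear_zero[OF sub] by simp
  have "q (c *\<^sub>R x) = c * q x" for c x
  proof (cases c "0::real" rule: linorder_cases)
    case less
    then show ?thesis using sublinear_scale[OF sub, of "- c" x] neg[of "c *\<^sub>R x"] by simp
  qed (use sublinear_scale[OF sub] sublinear_zero[OF sub] in auto)
  then show ?thesis using add by (intro linearI) auto
qed

text \<open>
  Both constraints, \<open>g \<le> p\<close> everywhere and \<open>g = f\<close> on \<open>S\<close>, are absorbed into the single sublinear
  functional \<open>x \<mapsto> inf {p (x - s) + f s | s \<in> S}\<close>: a linear functional below it is below \<open>p\<close> and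
  below \<open>f\<close> on \<open>S\<close>, and on a subspace \<open>g \<le> f\<close> forces equality. A minimal sublinear functional
  below it therefore is the extension.
\<close>

theorem Hahn_Banach_sublinear:
  fixes p :: "'v::real_vector \<Rightarrow> real" and f :: "'v \<Rightarrow> real"
  assumes p: "sublinear p" and S: "subspace S"
    and f_add: "\<And>x y. x \<in> S \<Longrightarrow> y \<in> S \<Longrightarrow> f (x + y) = f x + f y"
    and f_scale: "\<And>c x. x \<in> S \<Longrightarrow> f (c *\<^sub>R x) = c * f x"
    and f_le: "\<And>x. x \<in> S \<Longrightarrow> f x \<le> p x"
  obtains g where "linear g" "\<And>x. x \<in> S \<Longrightarrow> g x = f x" "\<And>x. g x \<le> p x"
proof -
  define r where "r = (\<lambda>x. INF s\<in>S. p (x - s) + f s)"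
  have ne: "S \<noteq> {}" using S subspace_0 by blast
  have f_neg: "f (- s) = - f s" if "s \<in> S" for s using f_scale[OF that, of "-1"] by simp
  have bdd: "bdd_below ((\<lambda>s. p (x - s) + f s) ` S)" for x
  proof (rule bdd_belowI2)
    fix s assume s: "s \<in> S"
    have "- f s \<le> p (- s)" using f_le[of "- s"] f_neg[OF s] subspace_neg[OF S s] by simp
    also have "\<dots> \<le> p (x - s) + p (- x)" using sublinear_add[OF p, of "x - s" "- x"] by simp
    finally show "- p (- x) \<le> p (x - s) + f s" by simp
  qed
  have lower: "r x \<le> p (x - s) + f s" if "s \<in> S" for x s
    unfolding r_def by (rule cINF_lower[OF bdd that])
  have "sublinear r"
    unfolding sublinear_def
  proof (intro conjI allI impI)
    fix x y
    have *: "r (x + y) \<le> (p (x - s) + f s) + (p (y - t) + f t)" if "s \<in> S" "t \<in> S" for s t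
    proof -
      have "r (x + y) \<le> p ((x - s) + (y - t)) + f (s + t)"
        using lower[OF subspace_add[OF S that], of "x + y"] by (simp add: algebra_simps)
      then show ?thesis using sublinear_add[OF p, of "x - s" "y - t"] f_add[OF that] by simp
    qed
    have "r (x + y) - (p (y - t) + f t) \<le> r x" if "t \<in> S" for t
      unfolding r_def[THEN fun_cong, of x]
      by (rule cINF_greatest[OF ne]) (use *[OF _ that] in \<open>simp add: algebra_simps\<close>)
    then have "r (x + y) - r x \<le> r y"
      unfolding r_def[THEN fun_cong, of y] by (intro cINF_greatest[OF ne]) (simp add: algebra_simps)
    then show "r (x + y) \<le> r x + r y" by simp
  next
    fix c :: real and x assume c: "0 < c"
    have "r (c *\<^sub>R x) / c \<le> p (x - s) + f s" if "s \<in> S" for s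
    proof -
      have "r (c *\<^sub>R x) \<le> p (c *\<^sub>R (x - s)) + f (c *\<^sub>R s)"
        using lower[OF subspace_scale[OF S that, of c], of "c *\<^sub>R x"]
        by (simp only: scaleR_diff_right)
      then show ?thesis using c unfolding sublinear_scale[OF p c] f_scale[OF that] by (simp add: field_simps)
    qed
    then have "r (c *\<^sub>R x) / c \<le> r x"
      unfolding r_def[THEN fun_cong, of x] by (intro cINF_greatest[OF ne])
    then show "r (c *\<^sub>R x) \<le> c * r x" using c by (simp add: field_simps)
  qed
  then obtain g where g: "sublinear g" "g \<le> r" "\<And>q. sublinear q \<Longrightarrow> q \<le> g \<Longrightarrow> q = g"
    by (rule minimal_sublinear_exists) blast
  then have lin: "linear g" using minimal_sublinear_imp_linear by blast
  have f0: "f 0 = 0" using f_scale[OF subspace_0[OF S], of 0] by simp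
  have gp: "g x \<le> p x" for x
    using lower[OF subspace_0[OF S], of x] g(2) f0 order_trans[of "g x" "r x" "p x"] by (simp add: le_fun_def)
  have gf: "g s \<le> f s" if "s \<in> S" for s
    using lower[OF that, of s] g(2) sublinear_zero[OF p] order_trans[of "g s" "r s" "f s"]
    by (simp add: le_fun_def)
  have "g s = f s" if "s \<in> S" for s
    using gf[OF that] gf[OF subspace_neg[OF S that]] f_neg[OF that] linear_neg[OF lin, of s] by simp
  with lin gp that show ?thesis by blast
qed

section \<open>Complex functionals on bounded continuous functions\<close>

lemma Bcontfun_apply:
  assumes "continuous_on UNIV g" "\<And>x. norm (g x) \<le> b"
  shows "apply_bcontfun (Bcontfun g) x = g x"
  using Bcontfun_inverse[OF bcontfun_normI[OF assms]] by simp

lemma apply_scaleC_bcontfun [simp]: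
  "apply_bcontfun (scaleC_bcontfun c f) x = c * apply_bcontfun f x"
  unfolding scaleC_bcontfun_def
  by (rule Bcontfun_apply[where b = "cmod c * norm f"])
     (auto intro!: continuous_intros mult_left_mono norm_bounded simp: norm_mult)

lemma norm_scaleC_bcontfun_le: "norm (scaleC_bcontfun c f) \<le> cmod c * norm f"
  by (rule norm_bound) (auto intro!: mult_left_mono norm_bounded simp: norm_mult)

lemma scaleC_bcontfun_of_real: "scaleC_bcontfun (of_real r) f = r *\<^sub>R f"
  by (rule bcontfun_eqI) (simp add: scaleR_conv_of_real)

definition bounded_clinear_functional :: "(('k::t2_space \<Rightarrow>\<^sub>C complex) \<Rightarrow> complex) \<Rightarrow> bool" where
  "bounded_clinear_functional m \<longleftrightarrow>
     (\<forall>f g. m (f + g) = m f + m g) \<and>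
     (\<forall>c f. m (scaleC_bcontfun c f) = c * m f) \<and>
     (\<exists>B. \<forall>f. cmod (m f) \<le> B * norm f)"

text \<open>
  The real part of a complex-linear functional determines it: \<open>m f = Re (m f) - \<i> Re (m (\<i> f))\<close>.
  Extending the real part and reading this formula backwards extends \<open>m\<close>. The bound may double;
  only boundedness is preserved here.
\<close>

lemma complex_linear_extension:
  fixes m :: "('k::t2_space \<Rightarrow>\<^sub>C complex) \<Rightarrow> complex"
  assumes "0 \<in> S"
    and S_add: "\<And>f g. f \<in> S \<Longrightarrow> g \<in> S \<Longrightarrow> f + g \<in> S"
    and S_scale: "\<And>c f. f \<in> S \<Longrightarrow> scaleC_bcontfun c f \<in> S"
    and m_add: "\<And>f g. f \<in> S \<Longrightarrow> g \<in> S \<Longrightarrow> m (f + g) = m f + m g"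
    and m_scale: "\<And>c f. f \<in> S \<Longrightarrow> m (scaleC_bcontfun c f) = c * m f"
    and m_bdd: "\<And>f. f \<in> S \<Longrightarrow> cmod (m f) \<le> B * norm f"
  obtains M where "bounded_clinear_functional M" "\<And>f. f \<in> S \<Longrightarrow> M f = m f"
proof -
  define C where "C = \<bar>B\<bar>"
  have sub: "sublinear (\<lambda>f::'k \<Rightarrow>\<^sub>C complex. C * norm f)"
    unfolding sublinear_def C_def
    by (simp add: norm_triangle_ineq mult_left_mono flip: distrib_left)
  have S_scaleR: "c *\<^sub>R f \<in> S" if "f \<in> S" for c f
    using S_scale[OF that, of "of_real c"] by (simp add: scaleC_bcontfun_of_real)
  have ss: "subspace S" unfolding subspace_def using assms(1) S_add S_scaleR by blast
  have m_scaleR: "m (c *\<^sub>R f) = of_real c * m f" if "f \<in> S" for c f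
    using m_scale[OF that, of "of_real c"] by (simp add: scaleC_bcontfun_of_real)
  have le: "Re (m f) \<le> C * norm f" if "f \<in> S" for f
  proof -
    have "Re (m f) \<le> cmod (m f)" by (rule complex_Re_le_cmod)
    also have "\<dots> \<le> B * norm f" by (rule m_bdd[OF that])
    also have "\<dots> \<le> C * norm f" unfolding C_def by (intro mult_right_mono) auto
    finally show ?thesis .
  qed
  obtain u where u: "linear u" "\<And>f. f \<in> S \<Longrightarrow> u f = Re (m f)" "\<And>f. u f \<le> C * norm f"
  proof (rule Hahn_Banach_sublinear[OF sub ss, of "\<lambda>f. Re (m f)"])
    show "Re (m (f + g)) = Re (m f) + Re (m g)" if "f \<in> S" "g \<in> S" for f g
      using m_add[OF that] by simp
    show "Re (m (c *\<^sub>R f)) = c * Re (m f)" if "f \<in> S" for c f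
      using m_scaleR[OF that] by simp
  qed (use le in blast)+
  define M where "M f = Complex (u f) (- u (scaleC_bcontfun \<i> f))" for f
  have u_bdd: "\<bar>u f\<bar> \<le> C * norm f" for f
    using u(3)[of f] u(3)[of "- f"] linear_neg[OF u(1), of f] by simp
  have decomp: "scaleC_bcontfun c f = Re c *\<^sub>R f + Im c *\<^sub>R scaleC_bcontfun \<i> f"
    for c and f :: "'k \<Rightarrow>\<^sub>C complex"
    by (rule bcontfun_eqI) (simp add: complex_eq_iff)
  have u_scale: "u (scaleC_bcontfun c f) = Re c * u f + Im c * u (scaleC_bcontfun \<i> f)" for c f
    by (subst decomp) (simp add: linear_add[OF u(1)] linear_scale[OF u(1)])
  show ?thesis
  proof (rule that[of M])
    show "bounded_clinear_functional M"
      unfolding bounded_clinear_functional_def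
    proof (intro conjI allI)
      fix f g :: "'k \<Rightarrow>\<^sub>C complex"
      have "scaleC_bcontfun \<i> (f + g) = scaleC_bcontfun \<i> f + scaleC_bcontfun \<i> g"
        by (rule bcontfun_eqI) (simp add: algebra_simps)
      then show "M (f + g) = M f + M g" by (simp add: M_def linear_add[OF u(1)] complex_eq_iff)
    next
      fix c and f :: "'k \<Rightarrow>\<^sub>C complex"
      have "scaleC_bcontfun \<i> (scaleC_bcontfun c f) = scaleC_bcontfun (\<i> * c) f"
        by (rule bcontfun_eqI) simp
      then show "M (scaleC_bcontfun c f) = c * M f"
        by (simp add: M_def u_scale[of c] u_scale[of "\<i> * c"] complex_eq_iff algebra_simps)
    next
      have "cmod (M f) \<le> (C + C) * norm f" for f
      proof -
        have "\<bar>u (scaleC_bcontfun \<i> f)\<bar> \<le> C * norm f"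
          using order_trans[OF u_bdd[of "scaleC_bcontfun \<i> f"]
              mult_left_mono[OF norm_scaleC_bcontfun_le[of \<i> f], of C]]
          by (simp add: C_def)
        then show ?thesis
          using norm_triangle_le[of "complex_of_real (Re (M f))" "\<i> * complex_of_real (Im (M f))"]
            u_bdd[of f] complex_eq[of "M f"]
          by (simp add: M_def distrib_right norm_mult)
      qed
      then show "\<exists>B. \<forall>f. cmod (M f) \<le> B * norm f" by blast
    qed
    show "M f = m f" if "f \<in> S" for f
      using that by (simp add: M_def u(2) S_scale m_scale complex_eq_iff)
  qed
qed


lemma functional_add: "bounded_clinear_functional m \<Longrightarrow> m (f + g) = m f + m g"
  by (simp add: bounded_clinear_functional_def)

lemma functional_scale: "bounded_clinear_functional m \<Longrightarrow> m (scaleC_bcontfun c f) = c * m f"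
  by (simp add: bounded_clinear_functional_def)

lemma functional_diff:
  assumes "bounded_clinear_functional m"
  shows "m (f - g) = m f - m g"
  using functional_add[OF assms, of "f - g" g] by (simp add: algebra_simps)

lemma functional_sum:
  assumes "bounded_clinear_functional m"
  shows "m (\<Sum>i\<in>I. scaleC_bcontfun (c i) (f i)) = (\<Sum>i\<in>I. c i * m (f i))"
proof -
  have "m 0 = 0" using functional_diff[OF assms, of 0 0] by simp
  then show ?thesis
    by (induction I rule: infinite_finite_induct) (simp_all add: functional_add[OF assms] functional_scale[OF assms])
qed

lemma functional_bound:
  assumes "bounded_clinear_functional m"
  obtains B where "0 \<le> B" "\<And>f. cmod (m f) \<le> B * norm f"
proof -
  obtain B where B: "\<And>f. cmod (m f) \<le> B * norm f"
    using assms unfolding bounded_clinear_functional_def by blast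
  have "cmod (m f) \<le> \<bar>B\<bar> * norm f" for f
    using B[of f] mult_right_mono[OF abs_ge_self norm_ge_zero, of B f] by linarith
  then show ?thesis using that[of "\<bar>B\<bar>"] by simp
qed

lemma apply_bcontfun_sum:
  "apply_bcontfun (\<Sum>i\<in>I. f i) x = (\<Sum>i\<in>I. apply_bcontfun (f i) x)"
  by (induction I rule: infinite_finite_induct) simp_all

section \<open>Totally bounded families of functions\<close>

text \<open>
  Total boundedness of the range, phrased with nets of indices. The indices are what matters later:
  a net \<open>X\<close> for the translates of \<open>f\<close> consists of points of the space.
\<close>

definition totally_bounded_family :: "('i \<Rightarrow> 'v::metric_space) \<Rightarrow> bool" where
  "totally_bounded_family u \<longleftrightarrow> (\<forall>e>0. \<exists>X. finite X \<and> (\<forall>i. \<exists>j\<in>X. dist (u i) (u j) < e))"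

lemma totally_bounded_familyD:
  assumes "totally_bounded_family u" "0 < e"
  obtains X where "finite X" "\<And>i. \<exists>j\<in>X. dist (u i) (u j) < e"
  using assms unfolding totally_bounded_family_def by blast

text \<open>
  Completeness for an arbitrary topological domain: a uniform limit of bounded continuous functions
  is bounded and continuous.
\<close>

lemma complete_UNIV_bcontfun: "complete (UNIV :: ('a::topological_space \<Rightarrow>\<^sub>C 'b::complete_space) set)"
proof (rule completeI)
  fix f :: "nat \<Rightarrow> 'a \<Rightarrow>\<^sub>C 'b" assume "Cauchy f"
  have "uniformly_Cauchy_on UNIV (\<lambda>n. apply_bcontfun (f n))"
  proof (rule uniformly_Cauchy_onI)
    fix e :: real assume "0 < e"
    then obtain M where "\<forall>m\<ge>M. \<forall>n\<ge>M. dist (f m) (f n) < e"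
      using \<open>Cauchy f\<close> unfolding Cauchy_def by blast
    then show "\<exists>M. \<forall>x\<in>UNIV. \<forall>m\<ge>M. \<forall>n\<ge>M. dist (f m x) (f n x) < e"
      by (intro exI[of _ M]) (simp add: dist_fun_lt_imp_dist_val_lt)
  qed
  then have "uniformly_convergent_on UNIV (\<lambda>n. apply_bcontfun (f n))"
    by (rule Cauchy_uniformly_convergent)
  then obtain g where g: "uniform_limit UNIV (\<lambda>n. apply_bcontfun (f n)) g sequentially"
    unfolding uniformly_convergent_on_def by (elim exE)
  obtain l where "g = apply_bcontfun l" "f \<longlonglongrightarrow> l"
    by (rule uniform_limit_bcontfunE[OF g sequentially_bot])
  then show "\<exists>l\<in>UNIV. f \<longlonglongrightarrow> l" by (intro bexI[of _ l]) simp_all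
qed

lemma compact_closure_range_iff:
  fixes u :: "'i \<Rightarrow> 'v::metric_space"
  assumes "complete (UNIV :: 'v set)"
  shows "compact (closure (range u)) \<longleftrightarrow> totally_bounded_family u"
proof
  assume L: "compact (closure (range u))"
  show "totally_bounded_family u"
    unfolding totally_bounded_family_def
  proof (intro allI impI)
    fix e :: real assume "0 < e"
    then have pos: "0 < e / 2" by simp
    from conjunct2[OF L[unfolded compact_eq_totally_bounded], THEN spec, THEN mp, OF pos]
    obtain k where k: "finite k" "closure (range u) \<subseteq> (\<Union>x\<in>k. ball x (e / 2))"
      by (elim exE conjE)
    define X where "X = (\<lambda>x. SOME i. dist x (u i) < e / 2) ` k"
    have "\<exists>j\<in>X. dist (u i) (u j) < e" for i
    proof -
      have "u i \<in> closure (range u)" by (rule subsetD[OF closure_subset]) simp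
      then obtain x where x: "x \<in> k" "dist x (u i) < e / 2" using k(2) by auto
      define j where "j = (SOME i. dist x (u i) < e / 2)"
      have "dist x (u j) < e / 2" unfolding j_def using x(2) by (rule someI)
      then have "dist (u i) (u j) < e" using x(2) by (metis dist_commute dist_triangle_half_l)
      moreover have "j \<in> X" using x(1) by (auto simp: X_def j_def)
      ultimately show ?thesis by blast
    qed
    then show "\<exists>X. finite X \<and> (\<forall>i. \<exists>j\<in>X. dist (u i) (u j) < e)"
      using k(1) by (intro exI[of _ X]) (simp add: X_def)
  qed
next
  assume R: "totally_bounded_family u"
  have "\<exists>k. finite k \<and> closure (range u) \<subseteq> (\<Union>x\<in>k. ball x e)" if "0 < e" for e
  proof -
    have pos: "0 < e / 2" using that by simp
    obtain X where X: "finite X" "\<And>i. \<exists>j\<in>X. dist (u i) (u j) < e / 2"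
      by (rule totally_bounded_familyD[OF R pos]) blast
    have "range u \<subseteq> (\<Union>j\<in>X. cball (u j) (e / 2))"
      using X(2) by (force simp: dist_commute intro: less_imp_le)
    then have "closure (range u) \<subseteq> (\<Union>j\<in>X. cball (u j) (e / 2))"
      using X(1) by (intro closure_minimal closed_UN) auto
    also have "\<dots> \<subseteq> (\<Union>x\<in>u ` X. ball x e)" using that by fastforce
    finally show ?thesis using X(1) by (intro exI[of _ "u ` X"]) simp
  qed
  then show "compact (closure (range u))"
    unfolding compact_eq_totally_bounded
    using complete_closed_subset[OF closed_closure subset_UNIV assms] by blast
qed

lemma totally_bounded_family_Lipschitz:
  assumes u: "totally_bounded_family u" and "\<And>i j. dist (v i) (v j) \<le> C * dist (u i) (u j)"
  shows "totally_bounded_family v"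
  unfolding totally_bounded_family_def
proof (intro allI impI)
  fix e :: real assume "0 < e"
  then have pos: "0 < e / (\<bar>C\<bar> + 1)" by simp
  obtain X where X: "finite X" "\<And>i. \<exists>j\<in>X. dist (u i) (u j) < e / (\<bar>C\<bar> + 1)"
    by (rule totally_bounded_familyD[OF u pos]) blast
  have "dist (v i) (v j) < e" if "dist (u i) (u j) < e / (\<bar>C\<bar> + 1)" for i j
  proof -
    have "dist (v i) (v j) \<le> C * dist (u i) (u j)" by (rule assms)
    also have "\<dots> \<le> (\<bar>C\<bar> + 1) * dist (u i) (u j)" by (intro mult_right_mono) auto
    also have "\<dots> < e" using that by (simp add: field_simps)
    finally show ?thesis .
  qed
  then show "\<exists>X. finite X \<and> (\<forall>i. \<exists>j\<in>X. dist (v i) (v j) < e)" using X by meson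
qed

lemma totally_bounded_family_common_net:
  assumes "finite I" and u: "\<And>i. i \<in> I \<Longrightarrow> totally_bounded_family (u i)" and "0 < e"
  obtains X where "finite X" "\<And>x. \<exists>x'\<in>X. \<forall>i\<in>I. dist (u i x) (u i x') < e"
proof -
  have "\<exists>N c. finite N \<and> (\<forall>x. c x \<in> N \<and> dist (u i x) (u i (c x)) < e / 2)" if i: "i \<in> I" for i
  proof -
    have pos: "0 < e / 2" using \<open>0 < e\<close> by simp
    obtain N where "finite N" "\<And>x. \<exists>y\<in>N. dist (u i x) (u i y) < e / 2"
      by (rule totally_bounded_familyD[OF u[OF i] pos]) blast
    then have "\<forall>x. \<exists>y. y \<in> N \<and> dist (u i x) (u i y) < e / 2" by blast
    from choice[OF this] \<open>finite N\<close> show ?thesis by blast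
  qed
  then obtain N c where N: "\<And>i. i \<in> I \<Longrightarrow> finite (N i)"
    and c: "\<And>i x. i \<in> I \<Longrightarrow> c i x \<in> N i" "\<And>i x. i \<in> I \<Longrightarrow> dist (u i x) (u i (c i x)) < e / 2"
    by metis
  \<comment> \<open>points with the same net points for all \<open>i\<close> are close, and there are finitely many patterns\<close>
  define k where "k x = restrict (\<lambda>i. c i x) I" for x
  have "range k \<subseteq> PiE I N" using c(1) by (auto simp: k_def)
  then have fin: "finite (range k)" by (rule finite_subset) (rule finite_PiE[OF \<open>finite I\<close> N])
  show ?thesis
  proof (rule that[of "inv k ` range k"])
    show "finite (inv k ` range k)" using fin by simp
    fix x
    have "k (inv k (k x)) = k x" by (rule f_inv_into_f) simp
    then obtain x' where x': "x' \<in> inv k ` range k" "k x' = k x" by blast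
    have "dist (u i x) (u i x') < e" if i: "i \<in> I" for i
    proof -
      have "c i x' = c i x" using fun_cong[OF x'(2), of i] i by (simp add: k_def)
      then show ?thesis using c(2)[OF i, of x] c(2)[OF i, of x'] by (metis dist_triangle_half_l)
    qed
    then show "\<exists>x'\<in>inv k ` range k. \<forall>i\<in>I. dist (u i x) (u i x') < e" using x'(1) by blast
  qed
qed

lemma totally_bounded_family_add:
  fixes u v :: "'i \<Rightarrow> 'v::real_normed_vector"
  assumes "totally_bounded_family u" "totally_bounded_family v"
  shows "totally_bounded_family (\<lambda>x. u x + v x)"
  unfolding totally_bounded_family_def
proof (intro allI impI)
  fix e :: real assume "0 < e"
  then have pos: "0 < e / 2" by simp
  have tb: "totally_bounded_family (if b then u else v)" for b using assms by simp
  obtain X where X: "finite X"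
    "\<And>x. \<exists>x'\<in>X. \<forall>b\<in>UNIV. dist ((if b then u else v) x) ((if b then u else v) x') < e / 2"
    by (rule totally_bounded_family_common_net[of "UNIV :: bool set" "\<lambda>b. if b then u else v",
          OF finite tb pos]) blast
  have "\<exists>x'\<in>X. dist (u x + v x) (u x' + v x') < e" for x
  proof -
    obtain x' where x': "x' \<in> X" "dist (u x) (u x') < e / 2" "dist (v x) (v x') < e / 2"
      using X(2)[of x] by (force simp: UNIV_bool)
    then have "dist (u x + v x) (u x' + v x') < e"
      using dist_triangle_add[of "u x" "v x" "u x'" "v x'"] by simp
    with x'(1) show ?thesis by blast
  qed
  with X(1) show "\<exists>X. finite X \<and> (\<forall>x. \<exists>x'\<in>X. dist (u x + v x) (u x' + v x') < e)" by blast
qed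

text \<open>
  If finitely many rows \<open>F(x\<^sub>i, -)\<close> are uniformly close to every row of a bounded kernel \<open>F\<close>, then two
  columns that nearly agree at the points \<open>x\<^sub>i\<close> nearly agree everywhere. The columns restricted to
  the \<open>x\<^sub>i\<close> range over a bounded set in a finite-dimensional space, so finitely many columns suffice.
\<close>

lemma totally_bounded_family_transpose:
  fixes u :: "'a::topological_space \<Rightarrow> ('b::topological_space \<Rightarrow>\<^sub>C complex)"
    and v :: "'b \<Rightarrow> ('a \<Rightarrow>\<^sub>C complex)"
  assumes u: "totally_bounded_family u" and uv: "\<And>x y. u x y = v y x"
  shows "totally_bounded_family v"
  unfolding totally_bounded_family_def
proof (intro allI impI)
  fix e :: real assume "0 < e"
  then have e4: "0 < e / 4" by simp
  obtain X where X: "finite X" "\<And>x. \<exists>x'\<in>X. dist (u x) (u x') < e / 4"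
    by (rule totally_bounded_familyD[OF u e4]) blast
  have "totally_bounded_family (apply_bcontfun (u x))" for x
    unfolding compact_closure_range_iff[OF complete_UNIV, symmetric] by simp
  then obtain Y where Y: "finite Y" "\<And>y. \<exists>y'\<in>Y. \<forall>x\<in>X. dist (u x y) (u x y') < e / 4"
    by (rule totally_bounded_family_common_net[OF X(1) _ e4, of "\<lambda>x. apply_bcontfun (u x)"]) blast+
  have "\<exists>y'\<in>Y. dist (v y) (v y') < e" for y
  proof -
    obtain y' where y': "y' \<in> Y" "\<And>x. x \<in> X \<Longrightarrow> dist (u x y) (u x y') < e / 4" using Y(2) by blast
    have "dist (v y x) (v y' x) \<le> 3 * (e / 4)" for x
    proof -
      obtain x' where x': "x' \<in> X" "dist (u x) (u x') < e / 4" using X(2) by blast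
      have "dist (u x y) (u x y') \<le> dist (u x y) (u x' y) + dist (u x' y) (u x' y') + dist (u x' y') (u x y')"
        using dist_triangle[of "u x y" "u x y'" "u x' y"] dist_triangle[of "u x' y" "u x y'" "u x' y'"]
        by linarith
      also have "\<dots> \<le> 3 * (e / 4)"
        using dist_bounded[of "u x" y "u x'"] dist_bounded[of "u x'" y' "u x"] x'(2) y'(2)[OF x'(1)]
          dist_commute[of "u x'" "u x"]
        by linarith
      finally show ?thesis by (simp add: uv)
    qed
    then have "dist (v y) (v y') \<le> 3 * (e / 4)" by (rule dist_bound)
    with y'(1) \<open>0 < e\<close> show ?thesis by (intro bexI[of _ y']) auto
  qed
  with Y(1) show "\<exists>Y. finite Y \<and> (\<forall>y. \<exists>y'\<in>Y. dist (v y) (v y') < e)" by blast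
qed

text \<open>
  Each of finitely many columns is continuous in \<open>x\<close>, and every column is uniformly close to one of
  them, so the columns are equicontinuous; this is continuity of the rows in the supremum norm.
\<close>

lemma continuous_on_transpose:
  fixes u :: "'a::topological_space \<Rightarrow> ('b::topological_space \<Rightarrow>\<^sub>C complex)"
    and v :: "'b \<Rightarrow> ('a \<Rightarrow>\<^sub>C complex)"
  assumes v: "totally_bounded_family v" and uv: "\<And>x y. u x y = v y x"
  shows "continuous_on UNIV u"
  unfolding continuous_on_def
proof (intro ballI tendstoI)
  fix x0 :: 'a and e :: real assume "0 < e"
  then have e4: "0 < e / 4" by simp
  obtain Y where Y: "finite Y" "\<And>y. \<exists>y'\<in>Y. dist (v y) (v y') < e / 4"
    by (rule totally_bounded_familyD[OF v e4]) blast
  have "\<forall>\<^sub>F x in at x0. dist (v y x) (v y x0) < e / 4" for y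
  proof (rule tendstoD[OF _ e4])
    show "(apply_bcontfun (v y) \<longlongrightarrow> v y x0) (at x0)"
      using continuous_on_apply_bcontfun[of UNIV "v y"] by (simp add: continuous_on_def)
  qed
  then have "\<forall>\<^sub>F x in at x0. \<forall>y\<in>Y. dist (v y x) (v y x0) < e / 4"
    using Y(1) by (simp add: eventually_ball_finite)
  then show "\<forall>\<^sub>F x in at x0. dist (u x) (u x0) < e"
  proof eventually_elim
    case (elim x)
    have "dist (u x y) (u x0 y) \<le> 3 * (e / 4)" for y
    proof -
      obtain y' where y': "y' \<in> Y" "dist (v y) (v y') < e / 4" using Y(2) by blast
      have "dist (v y x) (v y x0) \<le> dist (v y x) (v y' x) + dist (v y' x) (v y' x0) + dist (v y' x0) (v y x0)"
        using dist_triangle[of "v y x" "v y x0" "v y' x"] dist_triangle[of "v y' x" "v y x0" "v y' x0"]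
        by linarith
      also have "\<dots> \<le> 3 * (e / 4)"
        using dist_bounded[of "v y" x "v y'"] dist_bounded[of "v y'" x0 "v y"] y' elim
          dist_commute[of "v y'" "v y"] by fastforce
      finally show ?thesis by (simp add: uv)
    qed
    then have "dist (u x) (u x0) \<le> 3 * (e / 4)" by (rule dist_bound)
    with \<open>0 < e\<close> show ?case by simp
  qed
qed

section \<open>Interchanging two functionals\<close>

text \<open>
  The coefficients \<open>P i\<close> are a partition of unity subordinate to the cover by the sets on which
  \<open>u x\<close> is within \<open>e\<close> of \<open>u i\<close>, for \<open>i\<close> in a finite net. They are continuous because \<open>u\<close> is.
\<close>

lemma finite_rank_approximation:
  fixes u :: "'a::t2_space \<Rightarrow> ('b::t2_space \<Rightarrow>\<^sub>C complex)"
  assumes u: "totally_bounded_family u" and cont: "continuous_on UNIV u" and "0 < e"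
  obtains X and P :: "'a \<Rightarrow> ('a \<Rightarrow>\<^sub>C complex)" where "finite X"
    "\<And>x. norm (u x - (\<Sum>i\<in>X. scaleC_bcontfun (P i x) (u i))) \<le> e"
proof -
  obtain X where X: "finite X" "\<And>x. \<exists>x'\<in>X. dist (u x) (u x') < e"
    by (rule totally_bounded_familyD[OF u \<open>0 < e\<close>]) blast
  define h where "h i x = max 0 (e - dist (u x) (u i))" for i x
  define s where "s x = (\<Sum>i\<in>X. h i x)" for x
  have h0: "0 \<le> h i x" for i x by (simp add: h_def)
  have s_pos: "0 < s x" for x
  proof -
    obtain i where i: "i \<in> X" "dist (u x) (u i) < e" using X(2) by blast
    then have "0 < h i x" by (simp add: h_def)
    also have "h i x \<le> s x" unfolding s_def by (rule member_le_sum[OF i(1)]) (auto simp: h0 X(1))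
    finally show ?thesis .
  qed
  have h_cont: "continuous_on UNIV (h i)" for i
    unfolding h_def by (intro continuous_intros cont)
  have s_cont: "continuous_on UNIV s"
    unfolding s_def by (intro continuous_intros h_cont)
  define P where "P i = Bcontfun (\<lambda>x. complex_of_real (h i x / s x))" for i
  have P: "P i x = of_real (h i x / s x)" if i: "i \<in> X" for i x
    unfolding P_def
  proof (rule Bcontfun_apply[where b = 1])
    show "continuous_on UNIV (\<lambda>x. complex_of_real (h i x / s x))"
      using s_pos by (intro continuous_intros h_cont s_cont) (auto simp: less_imp_neq[symmetric])
    fix x
    have "h i x \<le> s x" unfolding s_def by (rule member_le_sum[OF i]) (auto simp: h0 X(1))
    then show "cmod (complex_of_real (h i x / s x)) \<le> 1" using s_pos[of x] h0[of i x]
      by (simp add: norm_divide)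
  qed
  have "norm (u x - (\<Sum>i\<in>X. scaleC_bcontfun (P i x) (u i))) \<le> e" for x
  proof -
    have sum1: "(\<Sum>i\<in>X. h i x / s x) = 1"
      using s_pos[of x] by (simp add: s_def sum_divide_distrib[symmetric])
    have "(\<Sum>i\<in>X. scaleC_bcontfun (P i x) (u i)) = (\<Sum>i\<in>X. (h i x / s x) *\<^sub>R u i)"
      by (intro sum.cong refl) (simp add: P scaleC_bcontfun_of_real del: of_real_divide)
    then have "u x - (\<Sum>i\<in>X. scaleC_bcontfun (P i x) (u i))
        = (\<Sum>i\<in>X. h i x / s x) *\<^sub>R u x - (\<Sum>i\<in>X. (h i x / s x) *\<^sub>R u i)"
      by (simp add: sum1)
    also have "\<dots> = (\<Sum>i\<in>X. (h i x / s x) *\<^sub>R (u x - u i))"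
      by (simp add: scaleR_sum_left sum_subtractf scaleR_diff_right)
    also have "norm \<dots> \<le> (\<Sum>i\<in>X. (h i x / s x) * e)"
    proof (rule sum_norm_le)
      fix i assume "i \<in> X"
      have "h i x * norm (u x - u i) \<le> h i x * e"
      proof (cases "h i x = 0")
        case False
        then have "dist (u x) (u i) < e" by (simp add: h_def max_def split: if_splits)
        then show ?thesis using h0[of i x] by (intro mult_left_mono) (auto simp: dist_norm)
      qed simp
      then show "norm ((h i x / s x) *\<^sub>R (u x - u i)) \<le> h i x / s x * e"
        using s_pos[of x] h0[of i x] divide_right_mono[of _ _ "s x"] by (simp add: less_imp_le)
    qed
    also have "\<dots> = e" by (simp only: sum_distrib_right[symmetric] sum1 mult_1)
    finally show ?thesis .
  qed
  with X(1) that show ?thesis by blast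
qed

lemma apply_functional_family:
  fixes u :: "'a::topological_space \<Rightarrow> ('b::t2_space \<Rightarrow>\<^sub>C complex)"
  assumes m: "bounded_clinear_functional m" and u: "continuous_on UNIV u" "\<And>x. norm (u x) \<le> b"
  shows "Bcontfun (\<lambda>x. m (u x)) x = m (u x)"
proof -
  obtain B where B: "0 \<le> B" "\<And>f. cmod (m f) \<le> B * norm f" by (rule functional_bound[OF m]) blast
  have lip: "dist (m f) (m g) \<le> B * dist f g" for f g
    using B(2)[of "f - g"] by (simp add: dist_norm functional_diff[OF m])
  have "B-lipschitz_on UNIV m" by (rule lipschitz_onI) (auto simp: lip B(1))
  then have "continuous_on UNIV m" by (rule lipschitz_on_continuous_on)
  then have c: "continuous_on UNIV (\<lambda>x. m (u x))"
    by (rule continuous_on_compose2[OF _ u(1)]) simp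
  show ?thesis
  proof (rule Bcontfun_apply[OF c])
    show "cmod (m (u x)) \<le> B * b" for x
      using B(2)[of "u x"] mult_left_mono[OF u(2)[of x] B(1)] by linarith
  qed
qed

text \<open>
  A kernel with totally bounded rows is a uniform limit of finite sums of products, and for a
  product the order in which the two functionals are applied does not matter.
\<close>

lemma functional_Fubini:
  fixes u :: "'a::t2_space \<Rightarrow> ('b::t2_space \<Rightarrow>\<^sub>C complex)"
    and v :: "'b \<Rightarrow> ('a \<Rightarrow>\<^sub>C complex)"
  assumes m: "bounded_clinear_functional m" and n: "bounded_clinear_functional n"
    and u: "totally_bounded_family u" and uv: "\<And>x y. u x y = v y x"
    and bdd: "\<And>x. norm (u x) \<le> b"
  shows "m (Bcontfun (\<lambda>x. n (u x))) = n (Bcontfun (\<lambda>y. m (v y)))"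
proof -
  have v: "totally_bounded_family v" by (rule totally_bounded_family_transpose[OF u uv])
  have cont: "continuous_on UNIV u" "continuous_on UNIV v"
    using continuous_on_transpose[OF v uv] continuous_on_transpose[OF u, of v] uv by auto
  have bdd': "norm (v y) \<le> b" for y
    using order_trans[OF norm_bounded bdd] by (intro norm_bound) (simp flip: uv)
  define F where "F = Bcontfun (\<lambda>x. n (u x))"
  define G where "G = Bcontfun (\<lambda>y. m (v y))"
  have F: "F x = n (u x)" for x unfolding F_def by (rule apply_functional_family[OF n cont(1) bdd])
  have G: "G y = m (v y)" for y unfolding G_def by (rule apply_functional_family[OF m cont(2) bdd'])
  obtain Bm where Bm: "0 \<le> Bm" "\<And>f. cmod (m f) \<le> Bm * norm f" by (rule functional_bound[OF m]) blast
  obtain Bn where Bn: "0 \<le> Bn" "\<And>f. cmod (n f) \<le> Bn * norm f" by (rule functional_bound[OF n]) blast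
  have main: "cmod (m F - n G) \<le> (2 * Bm * Bn) * e" if "0 < e" for e
  proof -
    obtain X and P :: "'a \<Rightarrow> ('a \<Rightarrow>\<^sub>C complex)" where X: "finite X"
      and P: "\<And>x. norm (u x - (\<Sum>i\<in>X. scaleC_bcontfun (P i x) (u i))) \<le> e"
      by (rule finite_rank_approximation[OF u cont(1) \<open>0 < e\<close>], rule that)
    let ?F = "\<Sum>i\<in>X. scaleC_bcontfun (n (u i)) (P i)"
    let ?G = "\<Sum>i\<in>X. scaleC_bcontfun (m (P i)) (u i)"
    have "norm (F - ?F) \<le> Bn * e"
    proof (rule norm_bound)
      fix x
      have "(F - ?F) x = n (u x - (\<Sum>i\<in>X. scaleC_bcontfun (P i x) (u i)))"
        by (simp add: F apply_bcontfun_sum functional_diff[OF n] functional_sum[OF n] mult.commute)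
      then show "cmod ((F - ?F) x) \<le> Bn * e"
        using order_trans[OF Bn(2) mult_left_mono[OF P[of x] Bn(1)]] by simp
    qed
    then have 1: "cmod (m (F - ?F)) \<le> Bm * (Bn * e)"
      by (intro order_trans[OF Bm(2)] mult_left_mono Bm(1))
    have "norm (G - ?G) \<le> Bm * e"
    proof (rule norm_bound)
      fix y
      have "norm (v y - (\<Sum>i\<in>X. scaleC_bcontfun (u i y) (P i))) \<le> e"
      proof (rule norm_bound)
        fix x
        have "(v y - (\<Sum>i\<in>X. scaleC_bcontfun (u i y) (P i))) x
            = (u x - (\<Sum>i\<in>X. scaleC_bcontfun (P i x) (u i))) y"
          by (simp add: apply_bcontfun_sum uv mult.commute)
        then show "cmod ((v y - (\<Sum>i\<in>X. scaleC_bcontfun (u i y) (P i))) x) \<le> e"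
          using order_trans[OF norm_bounded P[of x], of y] by simp
      qed
      moreover have "(G - ?G) y = m (v y - (\<Sum>i\<in>X. scaleC_bcontfun (u i y) (P i)))"
        by (simp add: G apply_bcontfun_sum functional_diff[OF m] functional_sum[OF m] mult.commute)
      ultimately show "cmod ((G - ?G) y) \<le> Bm * e"
        using order_trans[OF Bm(2) mult_left_mono[OF _ Bm(1)]] by simp
    qed
    then have 2: "cmod (n (G - ?G)) \<le> Bn * (Bm * e)"
      by (intro order_trans[OF Bn(2)] mult_left_mono Bn(1))
    have "m ?F = n ?G" by (simp add: functional_sum[OF m] functional_sum[OF n] mult.commute)
    then have "m F - n G = m (F - ?F) - n (G - ?G)" by (simp add: functional_diff[OF m] functional_diff[OF n])
    then have "cmod (m F - n G) \<le> Bm * (Bn * e) + Bn * (Bm * e)"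
      using order_trans[OF norm_triangle_ineq4 add_mono[OF 1 2]] by simp
    then show ?thesis by (simp add: algebra_simps)
  qed
  have "cmod (m F - n G) \<le> 0"
  proof (rule field_le_epsilon)
    fix e :: real assume "0 < e"
    define d where "d = e / (2 * Bm * Bn + 1)"
    have pos: "0 < 2 * Bm * Bn + 1" using Bm(1) Bn(1) by (simp add: add_nonneg_pos)
    then have "0 < d" using \<open>0 < e\<close> by (simp add: d_def)
    then have "(2 * Bm * Bn) * d \<le> (2 * Bm * Bn + 1) * d" by (intro mult_right_mono) auto
    also have "\<dots> = e" using pos by (simp add: d_def)
    finally show "cmod (m F - n G) \<le> 0 + e" using main[OF \<open>0 < d\<close>] by simp
  qed
  then show ?thesis by (simp add: F_def G_def)
qed


section \<open>Positive regular Borel measures\<close>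

definition positive_borel_measure :: "('k::topological_space set \<Rightarrow> complex) \<Rightarrow> bool" where
  "positive_borel_measure \<mu> \<longleftrightarrow> complex_borel_measure \<mu> \<and> (\<forall>A. \<mu> A \<in> \<real>\<^sub>\<ge>\<^sub>0)"

lemma M_plus_iff: "\<mu> \<in> M_plus \<longleftrightarrow> positive_borel_measure \<mu> \<and> regular_borel_measure \<mu>"
  by (auto simp: M_plus_def M_space_def positive_borel_measure_def)

lemma M_plus_subset_M_space: "\<mu> \<in> M_plus \<Longrightarrow> \<mu> \<in> M_space"
  by (simp add: M_plus_def)

lemma space_as_measure [simp]: "space (as_measure \<mu>) = UNIV"
  by (simp add: as_measure_def space_measure_of_conv)

lemma sets_as_measure [simp, measurable_cong]: "sets (as_measure (\<mu> :: 'k::topological_space set \<Rightarrow> complex)) = sets borel"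
  using sets.sets_measure_of_eq[of "borel :: 'k measure"] by (simp add: as_measure_def)

lemma
  assumes "positive_borel_measure \<mu>"
  shows positive_borel_measure_Re: "0 \<le> Re (\<mu> A)"
    and positive_borel_measure_of_real: "\<mu> A = of_real (Re (\<mu> A))"
proof -
  have "\<mu> A \<in> \<real>\<^sub>\<ge>\<^sub>0" using assms by (simp add: positive_borel_measure_def)
  then obtain r where "\<mu> A = of_real r" "0 \<le> r" by (rule nonneg_Reals_cases)
  then show "0 \<le> Re (\<mu> A)" "\<mu> A = of_real (Re (\<mu> A))" by simp_all
qed

lemma emeasure_as_measure:
  fixes \<mu> :: "'k::topological_space set \<Rightarrow> complex"
  assumes \<mu>: "positive_borel_measure \<mu>" and A: "A \<in> sets borel"
  shows "emeasure (as_measure \<mu>) A = ennreal (Re (\<mu> A))"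
  unfolding as_measure_def
proof (rule emeasure_measure_of_sigma[OF _ _ _ A])
  show "sigma_algebra UNIV (sets (borel :: 'k measure))"
    using sets.sigma_algebra_axioms[of "borel :: 'k measure"] by simp
  have add: "(\<lambda>n. \<mu> (E n)) sums \<mu> (\<Union>n. E n)"
    if "range E \<subseteq> sets borel" "disjoint_family E" for E :: "nat \<Rightarrow> 'k set"
    using \<mu> that unfolding positive_borel_measure_def complex_borel_measure_def by blast
  have "(\<lambda>n::nat. \<mu> {}) sums \<mu> {}"
    using add[of "\<lambda>_. {}"] by (simp add: disjoint_family_on_def)
  then have "summable (\<lambda>n::nat. \<mu> {})" by (rule sums_summable)
  then have "\<mu> {} = 0" by (simp only: summable_const_iff)
  then show "positive (sets borel) (\<lambda>A. ennreal (Re (\<mu> A)))" by (simp add: positive_def)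
  show "countably_additive (sets borel) (\<lambda>A. ennreal (Re (\<mu> A)))"
    unfolding countably_additive_def
  proof (intro allI impI)
    fix E :: "nat \<Rightarrow> 'k set" assume "range E \<subseteq> sets borel" "disjoint_family E"
    then have "(\<lambda>n. Re (\<mu> (E n))) sums Re (\<mu> (\<Union>n. E n))" by (rule sums_Re[OF add])
    then show "(\<Sum>n. ennreal (Re (\<mu> (E n)))) = ennreal (Re (\<mu> (\<Union>n. E n)))"
      by (rule suminf_ennreal_eq[OF positive_borel_measure_Re[OF \<mu>]])
  qed
qed

lemma finite_measure_as_measure:
  assumes "positive_borel_measure \<mu>"
  shows "finite_measure (as_measure \<mu>)"
  by (rule finite_measureI) (simp add: emeasure_as_measure[OF assms])

text \<open>
  For a positive measure every countable partition of \<open>A\<close> yields the same sum, namely the measure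
  of \<open>A\<close>.
\<close>

lemma total_variation_positive:
  fixes \<mu> :: "'k::topological_space set \<Rightarrow> complex"
  assumes \<mu>: "positive_borel_measure \<mu>" and A: "A \<in> sets borel"
  shows "total_variation \<mu> A = emeasure (as_measure \<mu>) A"
proof -
  have ne: "S \<noteq> {}" if "x \<in> S" for x :: "nat \<Rightarrow> 'k set" and S using that by blast
  let ?P = "{E :: nat \<Rightarrow> 'k set. range E \<subseteq> sets borel \<and> disjoint_family E \<and> (\<Union>n. E n) = A}"
  have "(\<Sum>n. ennreal (cmod (\<mu> (E n)))) = emeasure (as_measure \<mu>) A" if "E \<in> ?P" for E
  proof -
    have E: "E n \<in> sets borel" for n using that by auto
    have "cmod (\<mu> (E n)) = Re (\<mu> (E n))" for n
      using positive_borel_measure_Re[OF \<mu>, of "E n"]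
      by (subst positive_borel_measure_of_real[OF \<mu>]) (simp only: norm_of_real abs_of_nonneg)
    then have "(\<Sum>n. ennreal (cmod (\<mu> (E n)))) = (\<Sum>n. emeasure (as_measure \<mu>) (E n))"
      by (simp add: emeasure_as_measure[OF \<mu> E])
    also have "\<dots> = emeasure (as_measure \<mu>) (\<Union>n. E n)"
      by (rule suminf_emeasure) (use that in auto)
    finally show ?thesis using that by simp
  qed
  then have "total_variation \<mu> A = (SUP E\<in>?P. emeasure (as_measure \<mu>) A)"
    unfolding total_variation_def by (intro SUP_cong refl)
  moreover have "(\<lambda>n::nat. if n = 0 then A else {}) \<in> ?P"
    using A by (auto simp: disjoint_family_on_def split: if_splits)
  then have "?P \<noteq> {}" by (rule ne)
  ultimately show ?thesis by (simp only: SUP_constant if_False)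
qed

lemma M_plus_inner_regular:
  fixes \<mu> :: "'k::t2_space set \<Rightarrow> complex"
  assumes \<mu>: "\<mu> \<in> M_plus" and "0 < e"
  obtains C where "compact C" "measure (as_measure \<mu>) (- C) < e"
proof -
  have pos: "positive_borel_measure \<mu>" and reg: "regular_borel_measure \<mu>"
    using \<mu> by (simp_all add: M_plus_iff)
  interpret finite_measure "as_measure \<mu>" by (rule finite_measure_as_measure[OF pos])
  let ?M = "as_measure \<mu>"
  have Cb: "C \<in> sets borel" if "compact C" for C :: "'k set"
    using that by (intro borel_closed compact_imp_closed)
  have "total_variation \<mu> UNIV = (SUP C \<in> {C. compact C \<and> C \<subseteq> UNIV}. total_variation \<mu> C)"
    by (rule conjunct2[OF bspec[OF reg[unfolded regular_borel_measure_def]]]) simp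
  also have "\<dots> = (SUP C \<in> {C. compact C}. emeasure ?M C)"
    by (intro SUP_cong) (simp_all add: total_variation_positive[OF pos Cb])
  finally have eq: "emeasure ?M UNIV = (SUP C \<in> {C. compact C}. emeasure ?M C)"
    by (simp add: total_variation_positive[OF pos])
  show ?thesis
  proof (cases "emeasure ?M UNIV = 0")
    case True
    have "measure ?M (- {}) < e" using True \<open>0 < e\<close> by (simp add: measure_def)
    then show ?thesis by (rule that[of "{}", rotated]) simp
  next
    case False
    then have "emeasure ?M UNIV - ennreal e < emeasure ?M UNIV"
      using \<open>0 < e\<close> emeasure_finite[of UNIV] by (intro ennreal_between) (auto simp: zero_less_iff_neq_zero less_top[symmetric])
    then obtain C where C: "compact C" "emeasure ?M UNIV - ennreal e < emeasure ?M C"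
      by (subst (asm) (2) eq) (auto simp: less_SUP_iff)
    have "ennreal (measure ?M UNIV - e) < ennreal (measure ?M C)"
      using C(2) \<open>0 < e\<close> by (simp add: emeasure_eq_measure ennreal_minus)
    then have "measure ?M UNIV - e < measure ?M C" by (metis ennreal_leI not_le)
    moreover have "measure ?M (- C) = measure ?M UNIV - measure ?M C"
      using finite_measure_compl[of C] Cb[OF C(1)] by (simp add: Compl_eq_Diff_UNIV)
    ultimately show ?thesis using C(1) that by simp
  qed
qed

lemma integrable_bounded_continuous:
  fixes g :: "'k::t2_space \<Rightarrow> 'b::{banach,second_countable_topology}"
  assumes "finite_measure M" "sets M = sets borel" "continuous_on UNIV g" "\<And>x. norm (g x) \<le> b"
  shows "integrable M g"
proof -
  interpret finite_measure M by fact
  have "g \<in> borel_measurable borel" using assms(3) by (rule borel_measurable_continuous_onI)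
  then have "g \<in> borel_measurable M" by (simp add: measurable_cong_sets[OF assms(2) refl])
  then show ?thesis by (intro integrable_const_bound[where B = b]) (simp_all add: assms(4))
qed

lemma nn_integral_finite_combination:
  fixes M :: "'i \<Rightarrow> 'a measure"
  assumes sets: "\<And>i. i \<in> I \<Longrightarrow> sets (M i) = sets N"
    and N: "\<And>A. A \<in> sets N \<Longrightarrow> emeasure N A = (\<Sum>i\<in>I. ennreal (c i) * emeasure (M i) A)"
    and u: "u \<in> borel_measurable N"
  shows "(\<integral>\<^sup>+x. u x \<partial>N) = (\<Sum>i\<in>I. ennreal (c i) * (\<integral>\<^sup>+x. u x \<partial>M i))"
  using u
proof (induction rule: borel_measurable_induct)
  case (cong f g)
  have "space (M i) = space N" if "i \<in> I" for i using sets[OF that] by (rule sets_eq_imp_space_eq)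
  with cong show ?case by (simp cong: nn_integral_cong_simp)
next
  case (set A)
  then show ?case using sets N by (simp add: nn_integral_indicator)
next
  case (mult u d)
  have "u \<in> borel_measurable (M i)" if "i \<in> I" for i
    using mult(2) by (simp add: measurable_cong_sets[OF sets[OF that] refl])
  with mult show ?case by (simp add: nn_integral_cmult sum_distrib_left mult_ac)
next
  case (add u v)
  have "u \<in> borel_measurable (M i)" "v \<in> borel_measurable (M i)" if "i \<in> I" for i
    using add(1,3) by (simp_all add: measurable_cong_sets[OF sets[OF that] refl])
  with add show ?case by (simp add: nn_integral_add sum.distrib distrib_left)
next
  case (seq U)
  have U: "U j \<in> borel_measurable (M i)" if "i \<in> I" for i j
    using seq(1) by (simp add: measurable_cong_sets[OF sets[OF that] refl])
  have lim: "(\<lambda>j. \<integral>\<^sup>+x. U j x \<partial>L) \<longlonglongrightarrow> (\<integral>\<^sup>+x. (SUP j. U j) x \<partial>L)"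
    if "\<And>j. U j \<in> borel_measurable L" for L
  proof (rule nn_integral_LIMSEQ[OF \<open>incseq U\<close> that])
    fix x show "(\<lambda>j. U j x) \<longlonglongrightarrow> (SUP j. U j) x"
      using \<open>incseq U\<close> by (simp add: image_comp) (intro LIMSEQ_SUP, auto simp: incseq_def le_fun_def)
  qed
  have "(\<lambda>j. \<Sum>i\<in>I. ennreal (c i) * (\<integral>\<^sup>+x. U j x \<partial>M i))
      \<longlonglongrightarrow> (\<Sum>i\<in>I. ennreal (c i) * (\<integral>\<^sup>+x. (SUP j. U j) x \<partial>M i))"
    by (intro tendsto_sum ennreal_tendsto_cmult lim U) simp_all
  then show ?case
    using LIMSEQ_unique[OF lim[OF seq(1)]] by (simp add: seq.IH)
qed

text \<open>
  The formula is transferred from nonnegative integrals to nonnegative bounded functions, to real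
  ones by adding a constant, and to complex ones by splitting into real and imaginary parts.
\<close>

lemma integral_finite_combination:
  fixes M :: "'i \<Rightarrow> 'k::t2_space measure" and g :: "'k \<Rightarrow> complex"
  assumes c: "\<And>i. i \<in> I \<Longrightarrow> 0 \<le> c i"
    and setsN: "sets N = sets borel" and sets: "\<And>i. i \<in> I \<Longrightarrow> sets (M i) = sets borel"
    and finN: "finite_measure N" and fin: "\<And>i. i \<in> I \<Longrightarrow> finite_measure (M i)"
    and N: "\<And>A. A \<in> sets borel \<Longrightarrow> emeasure N A = (\<Sum>i\<in>I. ennreal (c i) * emeasure (M i) A)"
    and g: "continuous_on UNIV g" "\<And>x. norm (g x) \<le> b"
  shows "(\<integral>x. g x \<partial>N) = (\<Sum>i\<in>I. of_real (c i) * (\<integral>x. g x \<partial>M i))"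
proof -
  note int = integrable_bounded_continuous
  have nonneg: "(\<integral>x. h x \<partial>N) = (\<Sum>i\<in>I. c i * (\<integral>x. h x \<partial>M i))"
    if h: "continuous_on UNIV h" "\<And>x. norm (h x) \<le> B" "\<And>x. 0 \<le> h x" for h :: "'k \<Rightarrow> real" and B
  proof -
    have nn: "(\<integral>\<^sup>+x. ennreal (h x) \<partial>L) = ennreal (\<integral>x. h x \<partial>L)"
      if "finite_measure L" "sets L = sets borel" for L
      by (rule nn_integral_eq_integral[OF int[OF that h(1,2)]]) (simp add: h(3))
    have "(\<lambda>x. ennreal (h x)) \<in> borel_measurable N"
      using borel_measurable_continuous_onI[OF h(1)]
      by (simp add: measurable_cong_sets[OF setsN refl])
    then have "ennreal (\<integral>x. h x \<partial>N) = (\<Sum>i\<in>I. ennreal (c i) * (\<integral>\<^sup>+x. ennreal (h x) \<partial>M i))"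
      using nn_integral_finite_combination[of I M N c] sets N setsN nn[OF finN setsN] by simp
    also have "\<dots> = (\<Sum>i\<in>I. ennreal (c i * (\<integral>x. h x \<partial>M i)))"
      by (intro sum.cong refl) (simp add: nn fin sets c ennreal_mult' )
    also have "\<dots> = ennreal (\<Sum>i\<in>I. c i * (\<integral>x. h x \<partial>M i))"
      by (intro sum_ennreal mult_nonneg_nonneg c integral_nonneg_AE AE_I2 h(3))
    finally show ?thesis
      by (subst (asm) ennreal_inj)
         (auto intro!: integral_nonneg_AE sum_nonneg mult_nonneg_nonneg c AE_I2 h(3))
  qed
  have real: "(\<integral>x. h x \<partial>N) = (\<Sum>i\<in>I. c i * (\<integral>x. h x \<partial>M i))"
    if h: "continuous_on UNIV h" "\<And>x. norm (h x) \<le> B" for h :: "'k \<Rightarrow> real" and B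
  proof -
    have B: "0 \<le> B" using norm_ge_zero h(2) by (rule order_trans)
    have h': "continuous_on UNIV (\<lambda>x. h x + B)" by (intro continuous_intros h(1))
    have "norm (h x + B) \<le> 2 * B" "0 \<le> h x + B" for x using h(2)[of x] B by auto
    note shifted = nonneg[OF h' this]
    have const: "(\<integral>x. B \<partial>N) = (\<Sum>i\<in>I. c i * (\<integral>x. B \<partial>M i))"
      by (rule nonneg[of _ B]) (use B in \<open>auto intro: continuous_intros\<close>)
    have split: "(\<integral>x. h x + B \<partial>L) = (\<integral>x. h x \<partial>L) + (\<integral>x. B \<partial>L)"
      if "finite_measure L" "sets L = sets borel" for L
      by (rule Bochner_Integration.integral_add[OF int[OF that h] int[OF that, of _ B]])
         (use B in \<open>auto intro: continuous_intros\<close>)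
    show ?thesis
      using shifted const by (simp add: split finN setsN fin sets distrib_left sum.distrib del: lebesgue_integral_const)
  qed
  have "norm (Re (g x)) \<le> b" "norm (Im (g x)) \<le> b" for x
    using order_trans[OF abs_Re_le_cmod g(2)] order_trans[OF abs_Im_le_cmod g(2)] by simp_all
  note Re = real[OF continuous_on_Re[OF g(1)] this(1)] and Im = real[OF continuous_on_Im[OF g(1)] this(2)]
  have parts: "(\<integral>x. Re (g x) \<partial>L) = Re (\<integral>x. g x \<partial>L)" "(\<integral>x. Im (g x) \<partial>L) = Im (\<integral>x. g x \<partial>L)"
    if "finite_measure L" "sets L = sets borel" for L
    using int[OF that g] by simp_all
  show ?thesis
    using Re Im by (simp add: complex_eq_iff parts finN setsN fin sets)
qed

definition discrete_measure :: "nat \<Rightarrow> (nat \<Rightarrow> real) \<Rightarrow> (nat \<Rightarrow> 'k::topological_space) \<Rightarrow> 'k set \<Rightarrow> complex" where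
  "discrete_measure n c w = (\<lambda>A. \<Sum>i<n. of_real (c i) * point_mass (w i) A)"

text \<open>
  Regularity is immediate for finitely many atoms: removing from the whole space the atoms outside
  \<open>A\<close> leaves an open set of the same measure as \<open>A\<close>, and the atoms inside \<open>A\<close> form a compact set of
  the same measure.
\<close>

lemma discrete_measure_M_plus:
  fixes w :: "nat \<Rightarrow> 'k::t2_space"
  assumes c: "\<And>i. 0 \<le> c i"
  shows "discrete_measure n c w \<in> M_plus"
proof -
  let ?d = "discrete_measure n c w"
  have pm: "(\<lambda>m. point_mass x (E m)) sums point_mass x (\<Union>m. E m)"
    if E: "range E \<subseteq> sets borel" "disjoint_family E" for E :: "nat \<Rightarrow> 'k set" and x
  proof (cases "x \<in> (\<Union>m. E m)")
    case True
    then obtain k where k: "x \<in> E k" by blast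
    then have "x \<in> E m \<longleftrightarrow> m = k" for m using E(2) unfolding disjoint_family_on_def by blast
    moreover have "E m \<in> sets borel" for m using E(1) by blast
    moreover have "(\<Union>m. E m) \<in> sets borel" using E(1) by (rule sets.countable_UN)
    ultimately show ?thesis
      using sums_single[of k "\<lambda>_. 1 :: complex"] k by (simp add: point_mass_def if_distrib cong: if_cong)
  qed (simp add: point_mass_def)
  have cb: "complex_borel_measure ?d"
    unfolding complex_borel_measure_def
  proof (intro conjI allI impI)
    show "?d A = 0" if "A \<notin> sets borel" for A using that by (simp add: discrete_measure_def point_mass_def)
    show "(\<lambda>m. ?d (E m)) sums ?d (\<Union>m. E m)"
      if "range E \<subseteq> sets borel" "disjoint_family E" for E :: "nat \<Rightarrow> 'k set"
      unfolding discrete_measure_def by (intro sums_sum sums_mult pm that)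
  qed
  have "?d A \<in> \<real>\<^sub>\<ge>\<^sub>0" for A
  proof -
    have "?d A = of_real (\<Sum>i<n. c i * (if A \<in> sets borel \<and> w i \<in> A then 1 else 0))"
      by (simp add: discrete_measure_def point_mass_def if_distrib cong: if_cong)
    then show ?thesis using c by (simp only: nonneg_Reals_of_real_iff) (auto intro!: sum_nonneg)
  qed
  with cb have pos: "positive_borel_measure ?d" by (simp add: positive_borel_measure_def)
  have same: "total_variation ?d A = total_variation ?d B"
    if "A \<in> sets borel" "B \<in> sets borel" "\<And>i. i < n \<Longrightarrow> w i \<in> A \<longleftrightarrow> w i \<in> B" for A B
  proof -
    have "?d A = ?d B" unfolding discrete_measure_def by (intro sum.cong) (simp_all add: point_mass_def that)
    with that show ?thesis by (simp add: total_variation_positive[OF pos] emeasure_as_measure[OF pos])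
  qed
  have mono: "total_variation ?d A \<le> total_variation ?d B"
    if "A \<in> sets borel" "B \<in> sets borel" "A \<subseteq> B" for A B
    using that by (simp add: total_variation_positive[OF pos] emeasure_mono)
  have closed_borel: "B \<in> sets borel" if "closed B" for B :: "'k set" using that by (rule borel_closed)
  have "regular_borel_measure ?d"
    unfolding regular_borel_measure_def
  proof (intro ballI conjI antisym)
    fix A :: "'k set" assume A: "A \<in> sets borel"
    show "total_variation ?d A \<le> (INF U \<in> {U. open U \<and> A \<subseteq> U}. total_variation ?d U)"
      by (intro INF_greatest mono A) auto
    let ?U = "- (w ` {..<n} - A)"
    have U: "open ?U" by (intro open_Compl finite_imp_closed) simp
    have "total_variation ?d ?U = total_variation ?d A"
      by (rule same[OF _ A]) (use U in \<open>auto simp del: Compl_Diff_eq\<close>)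
    then show "(INF U \<in> {U. open U \<and> A \<subseteq> U}. total_variation ?d U) \<le> total_variation ?d A"
      using U by (intro INF_lower2[of ?U]) (auto simp del: Compl_Diff_eq)
    show "(SUP C \<in> {C. compact C \<and> C \<subseteq> A}. total_variation ?d C) \<le> total_variation ?d A"
      by (intro SUP_least mono A) (auto intro!: closed_borel compact_imp_closed)
    let ?C = "w ` {..<n} \<inter> A"
    have C: "compact ?C" by (intro finite_imp_compact) simp
    have "total_variation ?d ?C = total_variation ?d A"
      by (rule same[OF _ A]) (use compact_imp_closed[OF C] in \<open>auto intro: closed_borel\<close>)
    then show "total_variation ?d A \<le> (SUP C \<in> {C. compact C \<and> C \<subseteq> A}. total_variation ?d C)"
      using C by (intro SUP_upper2[of ?C]) auto
  qed
  with pos show ?thesis by (simp add: M_plus_iff)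
qed

lemma point_mass_M_plus: "point_mass (x :: 'k::t2_space) \<in> M_plus"
proof -
  have "point_mass x = discrete_measure 1 (\<lambda>_. 1) (\<lambda>_. x)" by (simp add: discrete_measure_def)
  then show ?thesis using discrete_measure_M_plus[of "\<lambda>_. 1" 1 "\<lambda>_. x"] by simp
qed

lemma integral_M_plus_combination:
  fixes \<mu> :: "nat \<Rightarrow> 'k::t2_space set \<Rightarrow> complex" and g :: "'k \<Rightarrow> complex"
  assumes c: "\<And>i. 0 \<le> c i" and \<mu>: "\<And>i. \<mu> i \<in> M_plus"
    and sum: "(\<lambda>A. \<Sum>i<n. of_real (c i) * \<mu> i A) \<in> M_plus" (is "?s \<in> _")
    and g: "continuous_on UNIV g" "\<And>x. norm (g x) \<le> b"
  shows "(\<integral>x. g x \<partial>as_measure ?s) = (\<Sum>i<n. of_real (c i) * (\<integral>x. g x \<partial>as_measure (\<mu> i)))"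
proof (rule integral_finite_combination[OF _ _ _ _ _ _ g])
  have pos: "positive_borel_measure (\<mu> i)" "positive_borel_measure ?s" for i
    using \<mu> sum by (simp_all add: M_plus_iff)
  show "finite_measure (as_measure ?s)" "finite_measure (as_measure (\<mu> i))" for i
    by (rule finite_measure_as_measure, rule pos)+
  fix A :: "'k set" assume A: "A \<in> sets borel"
  have "emeasure (as_measure ?s) A = ennreal (\<Sum>i<n. c i * Re (\<mu> i A))"
    by (simp add: emeasure_as_measure[OF pos(2) A])
  also have "\<dots> = (\<Sum>i<n. ennreal (c i * Re (\<mu> i A)))"
    by (intro sum_ennreal[symmetric] mult_nonneg_nonneg c positive_borel_measure_Re pos)
  also have "\<dots> = (\<Sum>i<n. ennreal (c i) * emeasure (as_measure (\<mu> i)) A)"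
    by (simp add: emeasure_as_measure[OF pos(1) A] ennreal_mult'[OF c])
  finally show "emeasure (as_measure ?s) A = (\<Sum>i<n. ennreal (c i) * emeasure (as_measure (\<mu> i)) A)" .
qed (simp_all add: c)

lemma integral_point_mass:
  fixes g :: "'k::t2_space \<Rightarrow> 'b::{banach,second_countable_topology}"
  assumes "continuous_on UNIV g"
  shows "(\<integral>x. g x \<partial>as_measure (point_mass w)) = g w"
proof -
  have pos: "positive_borel_measure (point_mass w)" using point_mass_M_plus[of w] by (simp add: M_plus_iff)
  have "as_measure (point_mass w) = return borel w"
  proof (rule measure_eqI)
    fix A :: "'k set" assume "A \<in> sets (as_measure (point_mass w))"
    then have A: "A \<in> sets borel" by simp
    then show "emeasure (as_measure (point_mass w)) A = emeasure (return borel w) A"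
      by (simp add: emeasure_as_measure[OF pos A] point_mass_def indicator_def)
  qed simp
  then show ?thesis
    using integral_return[of w borel g] borel_measurable_continuous_onI[OF assms] by simp
qed


section \<open>The cone topology\<close>

lemma Cc_plus_bounded:
  assumes "f \<in> Cc_plus"
  obtains b where "\<And>x. norm (f x) \<le> b"
proof -
  let ?C = "closure {x. f x \<noteq> 0}"
  have "compact (f ` ?C)"
    using assms by (intro compact_continuous_image) (auto simp: Cc_plus_def intro: continuous_on_subset)
  then have "bounded (f ` ?C)" by (rule compact_imp_bounded)
  then obtain b where b: "\<forall>y\<in>f ` ?C. norm y \<le> b" unfolding bounded_iff by (elim exE)
  have "norm (f x) \<le> max b 0" for x
  proof (cases "f x = 0")
    case False
    then have "x \<in> ?C" by (intro subsetD[OF closure_subset]) simp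
    then show ?thesis using bspec[OF b, of "f x"] by (simp add: le_max_iff_disj)
  qed simp
  then show ?thesis by (rule that)
qed

lemma cone_generator_properties:
  assumes "f \<in> Cc_plus \<union> {\<lambda>_. 1}"
  shows "continuous_on UNIV f" and "\<exists>b. \<forall>x. norm (f x) \<le> b"
proof -
  show "continuous_on UNIV f" using assms by (auto simp: Cc_plus_def)
  show "\<exists>b. \<forall>x. norm (f x) \<le> b"
  proof (cases "f \<in> Cc_plus")
    case True
    then obtain b where "\<And>x. norm (f x) \<le> b" by (rule Cc_plus_bounded) blast
    then show ?thesis by blast
  next
    case False
    then have "f = (\<lambda>_. 1)" using assms by blast
    then show ?thesis by (intro exI[of _ 1]) simp
  qed
qed

lemma topspace_cone_topology [simp]: "topspace cone_topology = M_plus"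
proof -
  have "M_plus = {\<mu> \<in> M_plus. (\<integral>x. 1 \<partial>as_measure \<mu>) \<in> (UNIV :: real set)}" by simp
  then show ?thesis unfolding cone_topology_def topology_generated_by_topspace by blast
qed

lemma continuous_map_cone_generator:
  assumes "f \<in> Cc_plus \<union> {\<lambda>_. 1}"
  shows "continuous_map cone_topology euclidean (\<lambda>\<mu>. \<integral>x. f x \<partial>as_measure \<mu>)"
  unfolding continuous_map_def
proof (intro conjI allI impI)
  fix W :: "real set" assume "openin euclidean W"
  then have "open W" by simp
  then have "openin cone_topology {\<mu> \<in> M_plus. (\<integral>x. f x \<partial>as_measure \<mu>) \<in> W}"
    unfolding cone_topology_def using assms by (intro topology_generated_by_Basis) blast
  then show "openin cone_topology {\<mu> \<in> topspace cone_topology. (\<integral>x. f x \<partial>as_measure \<mu>) \<in> W}" by simp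
qed simp

lemma continuous_map_point_mass: "continuous_map euclidean cone_topology (point_mass :: 'k::t2_space \<Rightarrow> _)"
  unfolding cone_topology_def
proof (rule continuous_on_generated_topo)
  show "point_mass ` topspace euclidean
      \<subseteq> \<Union>{{\<mu> \<in> M_plus. (\<integral>x. f x \<partial>as_measure \<mu>) \<in> W} |f W. f \<in> Cc_plus \<union> {\<lambda>_::'k. 1::real} \<and> open W}"
    using topspace_cone_topology point_mass_M_plus
    unfolding cone_topology_def topology_generated_by_topspace by blast
  fix U :: "('k set \<Rightarrow> complex) set"
  assume "U \<in> {{\<mu> \<in> M_plus. (\<integral>x. f x \<partial>as_measure \<mu>) \<in> W} |f W. f \<in> Cc_plus \<union> {\<lambda>_. 1::real} \<and> open W}"
  then obtain f W where U: "U = {\<mu> \<in> M_plus. (\<integral>x. f x \<partial>as_measure \<mu>) \<in> W}"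
    and f: "f \<in> Cc_plus \<union> {\<lambda>_. 1::real}" and W: "open W" by blast
  have "point_mass -` U \<inter> topspace euclidean = f -` W"
    using integral_point_mass[OF cone_generator_properties(1)[OF f]] by (auto simp: U point_mass_M_plus)
  then show "openin euclidean (point_mass -` U \<inter> topspace euclidean)"
    using W cone_generator_properties(1)[OF f] by (simp add: open_vimage)
qed

text \<open>
  In this form a neighbourhood constrains only finitely many integrals, so that a measure can be
  replaced by a discrete one inside it.
\<close>

lemma cone_neighbourhood_base:
  fixes W :: "('k::t2_space set \<Rightarrow> complex) set"
  assumes "openin cone_topology W" "\<mu> \<in> W"
  obtains G e where "finite G" "G \<subseteq> Cc_plus \<union> {\<lambda>_. 1}" "0 < e"
    "\<And>\<nu>. \<nu> \<in> M_plus \<Longrightarrow> (\<And>g. g \<in> G \<Longrightarrow> \<bar>(\<integral>x. g x \<partial>as_measure \<nu>) - (\<integral>x. g x \<partial>as_measure \<mu>)\<bar> < e) \<Longrightarrow> \<nu> \<in> W"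
proof -
  let ?near = "\<lambda>G e \<nu>. \<forall>g\<in>G. \<bar>(\<integral>x. g x \<partial>as_measure \<nu>) - (\<integral>x. g x \<partial>as_measure \<mu>)\<bar> < e"
  let ?base = "\<lambda>W. \<exists>G e. finite G \<and> G \<subseteq> Cc_plus \<union> {\<lambda>_. 1} \<and> 0 < (e::real) \<and> (\<forall>\<nu>\<in>M_plus. ?near G e \<nu> \<longrightarrow> \<nu> \<in> W)"
  have "generate_topology_on {{\<mu> \<in> M_plus. (\<integral>x. f x \<partial>as_measure \<mu>) \<in> W} |f W. f \<in> Cc_plus \<union> {\<lambda>_::'k. 1::real} \<and> open W} W"
    using assms(1) unfolding cone_topology_def by (rule openin_topology_generated_by)
  then have "\<mu> \<in> W \<Longrightarrow> ?base W"
  proof (induction W)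
    case (Int a b)
    then have "\<mu> \<in> a" "\<mu> \<in> b" by auto
    from Int.IH(1)[OF this(1)] obtain Ga ea where
      a: "finite Ga" "Ga \<subseteq> Cc_plus \<union> {\<lambda>_. 1}" "0 < ea" "\<forall>\<nu>\<in>M_plus. ?near Ga ea \<nu> \<longrightarrow> \<nu> \<in> a"
      by (elim exE conjE)
    from Int.IH(2)[OF \<open>\<mu> \<in> b\<close>] obtain Gb eb where
      b: "finite Gb" "Gb \<subseteq> Cc_plus \<union> {\<lambda>_. 1}" "0 < eb" "\<forall>\<nu>\<in>M_plus. ?near Gb eb \<nu> \<longrightarrow> \<nu> \<in> b"
      by (elim exE conjE)
    have "\<nu> \<in> a \<inter> b" if "\<nu> \<in> M_plus" "?near (Ga \<union> Gb) (min ea eb) \<nu>" for \<nu>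
      using a(4) b(4) that by simp
    then show ?case using a b by (intro exI[of _ "Ga \<union> Gb"] exI[of _ "min ea eb"]) simp
  next
    case (UN K)
    then obtain k where k: "k \<in> K" "\<mu> \<in> k" by blast
    from UN.IH[OF this] obtain G e where "finite G" "G \<subseteq> Cc_plus \<union> {\<lambda>_. 1}" "0 < e"
      "\<forall>\<nu>\<in>M_plus. ?near G e \<nu> \<longrightarrow> \<nu> \<in> k" by (elim exE conjE)
    then show ?case using k(1) by (intro exI[of _ G] exI[of _ e]) blast
  next
    case (Basis s)
    then obtain f W where s: "s = {\<mu> \<in> M_plus. (\<integral>x. f x \<partial>as_measure \<mu>) \<in> W}"
      and f: "f \<in> Cc_plus \<union> {\<lambda>_. 1::real}" and W: "open W" by blast
    have "(\<integral>x. f x \<partial>as_measure \<mu>) \<in> W" using Basis.prems s by simp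
    from bspec[OF W[unfolded open_dist] this] obtain e where
      e: "0 < e" "\<forall>y. dist y (\<integral>x. f x \<partial>as_measure \<mu>) < e \<longrightarrow> y \<in> W" by (elim exE conjE)
    have "\<nu> \<in> s" if "\<nu> \<in> M_plus" "?near {f} e \<nu>" for \<nu>
      using that e(2) by (simp add: s dist_real_def)
    then show ?case using f e(1) by (intro exI[of _ "{f}"] exI[of _ e]) simp
  qed simp
  from this[OF assms(2)] obtain G e where "finite G" "G \<subseteq> Cc_plus \<union> {\<lambda>_. 1}" "0 < e"
      "\<forall>\<nu>\<in>M_plus. ?near G e \<nu> \<longrightarrow> \<nu> \<in> W" by (elim exE conjE)
  then show ?thesis by (intro that[of G e]) simp_all
qed

lemma locally_compact_cutoff:
  fixes C :: "'k::t2_space set"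
  assumes lc: "locally_compact_space (euclidean :: 'k topology)" and C: "compact C"
  obtains \<phi> :: "'k \<Rightarrow> real" where "continuous_on UNIV \<phi>" "\<And>x. 0 \<le> \<phi> x" "\<And>x. \<phi> x \<le> 1"
    "\<And>x. x \<in> C \<Longrightarrow> \<phi> x = 1" "compact (closure {x. \<phi> x \<noteq> 0})"
proof -
  have haus: "Hausdorff_space (euclidean :: 'k topology)"
    unfolding Hausdorff_space_def using hausdorff by (auto simp: disjnt_def)
  have "\<forall>x::'k. \<exists>U. open U \<and> compact (closure U) \<and> x \<in> U"
    using lc haus locally_compact_space_compact_closure_of[of "euclidean :: 'k topology"]
    by simp
  from choice[OF this] obtain U where
    "\<forall>x::'k. open (U x) \<and> compact (closure (U x)) \<and> x \<in> U x" by (elim exE)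
  then have U: "\<And>x::'k. open (U x)" "\<And>x. compact (closure (U x))" "\<And>x. x \<in> U x" by simp_all
  obtain D where D: "finite D" "C \<subseteq> (\<Union>x\<in>D. U x)"
    by (rule compactE_image[OF C, of C U]) (use U in auto)
  let ?V = "\<Union>x\<in>D. U x"
  have "open ?V" using U(1) by auto
  have cpt: "compact (\<Union>x\<in>D. closure (U x))" using D(1) U(2) by (intro compact_UN) auto
  have "closure ?V \<subseteq> (\<Union>x\<in>D. closure (U x))"
    using compact_imp_closed[OF cpt] closure_subset by (intro closure_minimal UN_mono) auto
  then have cV: "compact (closure ?V)"
    using compact_Int_closed[OF cpt closed_closure, of ?V] by (simp add: Int_absorb1)
  have reg: "completely_regular_space (euclidean :: 'k topology)"
    using lc haus locally_compact_Hausdorff_imp_regular_space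
      locally_compact_regular_imp_completely_regular_space by blast
  obtain \<phi> :: "'k \<Rightarrow> real" where \<phi>: "continuous_map euclidean (top_of_set {0..1}) \<phi>"
    "\<phi> ` (- ?V) \<subseteq> {0}" "\<phi> ` C \<subseteq> {1}"
  proof (rule Urysohn_completely_regular_compact_closed[OF _ reg, of 0 1 C "- ?V"])
    show "closedin euclidean (- ?V)"
      unfolding closed_closedin[symmetric] by (rule closed_Compl) fact
    show "disjnt C (- ?V)" unfolding disjnt_def using D(2) by blast
  qed (use C in simp_all)
  have "closure {x. \<phi> x \<noteq> 0} \<subseteq> closure ?V" using \<phi>(2) by (intro closure_mono) blast
  then have "compact (closure {x. \<phi> x \<noteq> 0})"
    using compact_Int_closed[OF cV closed_closure, of "{x. \<phi> x \<noteq> 0}"] by (simp add: Int_absorb1)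
  moreover have "continuous_on UNIV \<phi>" "\<And>x. 0 \<le> \<phi> x" "\<And>x. \<phi> x \<le> 1"
    using \<phi>(1) by (auto simp: continuous_map_in_subtopology)
  moreover have "\<phi> x = 1" if "x \<in> C" for x using \<phi>(3) that by blast
  ultimately show ?thesis by (intro that)
qed

text \<open>
  Cutting \<open>g\<close> off outside a compact set that carries almost all of the mass changes the integral by
  at most the bound of \<open>g\<close> times the remaining mass.
\<close>

lemma integral_approx_from_below:
  fixes \<mu> :: "'k::t2_space set \<Rightarrow> complex" and g :: "'k \<Rightarrow> real"
  assumes lc: "locally_compact_space (euclidean :: 'k topology)" and \<mu>: "\<mu> \<in> M_plus"
    and g: "continuous_on UNIV g" "\<And>x. 0 \<le> g x" "\<And>x. g x \<le> b"
    and a: "a < (\<integral>x. g x \<partial>as_measure \<mu>)"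
  obtains f where "f \<in> Cc_plus" "\<And>x. f x \<le> g x" "a < (\<integral>x. f x \<partial>as_measure \<mu>)"
proof -
  have pos: "positive_borel_measure \<mu>" using \<mu> by (simp add: M_plus_iff)
  interpret finite_measure "as_measure \<mu>" by (rule finite_measure_as_measure[OF pos])
  have b: "0 \<le> b" using g(2,3) order_trans by blast
  define e where "e = ((\<integral>x. g x \<partial>as_measure \<mu>) - a) / (b + 1)"
  have "0 < e" using a b by (simp add: e_def)
  then obtain C where C: "compact C" "measure (as_measure \<mu>) (- C) < e"
    by (rule M_plus_inner_regular[OF \<mu>]) blast
  obtain \<phi> :: "'k \<Rightarrow> real" where \<phi>: "continuous_on UNIV \<phi>" "\<And>x. 0 \<le> \<phi> x" "\<And>x. \<phi> x \<le> 1"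
    "\<And>x. x \<in> C \<Longrightarrow> \<phi> x = 1" "compact (closure {x. \<phi> x \<noteq> 0})"
    by (rule locally_compact_cutoff[OF lc C(1)]) blast
  define f where "f x = \<phi> x * g x" for x
  have f_le: "f x \<le> g x" for x
    unfolding f_def using mult_right_mono[OF \<phi>(3) g(2), of x x] by simp
  have f_nn: "0 \<le> f x" for x unfolding f_def using \<phi>(2) g(2) by simp
  have f_cont: "continuous_on UNIV f" unfolding f_def by (intro continuous_intros \<phi>(1) g(1))
  have "closure {x. f x \<noteq> 0} \<subseteq> closure {x. \<phi> x \<noteq> 0}"
    by (intro closure_mono) (auto simp: f_def)
  then have "compact (closure {x. f x \<noteq> 0})"
    using compact_Int_closed[OF \<phi>(5) closed_closure, of "{x. f x \<noteq> 0}"] by (simp add: Int_absorb1)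
  then have "f \<in> Cc_plus" using f_cont f_nn by (simp add: Cc_plus_def)
  have int_g: "integrable (as_measure \<mu>) g"
    by (rule integrable_bounded_continuous[OF finite_measure_axioms _ g(1), of b]) (simp_all add: g(2,3))
  have int_f: "integrable (as_measure \<mu>) f"
    by (rule integrable_bounded_continuous[OF finite_measure_axioms _ f_cont, of b])
       (use f_nn order_trans[OF f_le g(3)] in simp_all)
  have Cb: "- C \<in> sets (as_measure \<mu>)" using compact_imp_closed[OF C(1)] by (simp add: borel_closed)
  have "(\<integral>x. g x \<partial>as_measure \<mu>) - (\<integral>x. f x \<partial>as_measure \<mu>) = (\<integral>x. g x - f x \<partial>as_measure \<mu>)"
    using int_g int_f by simp
  also have "\<dots> \<le> (\<integral>x. b * indicator (- C) x \<partial>as_measure \<mu>)"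
  proof (rule integral_mono)
    show "integrable (as_measure \<mu>) (\<lambda>x. g x - f x)" using int_g int_f by simp
    show "integrable (as_measure \<mu>) (\<lambda>x. b * indicator (- C) x)"
      using Cb by (intro integrable_mult_right integrable_real_indicator) (simp_all add: less_top[symmetric])
    fix x
    show "g x - f x \<le> b * indicator (- C) x"
      using \<phi>(4)[of x] f_nn[of x] g(3)[of x] by (cases "x \<in> C") (simp_all add: f_def)
  qed
  also have "\<dots> = b * measure (as_measure \<mu>) (- C)" using Cb by simp
  also have "\<dots> \<le> b * e" using C(2) b by (intro mult_left_mono) auto
  also have "\<dots> < (b + 1) * e" using \<open>0 < e\<close> by simp
  also have "\<dots> = (\<integral>x. g x \<partial>as_measure \<mu>) - a" using b by (simp add: e_def)
  finally have "a < (\<integral>x. f x \<partial>as_measure \<mu>)" by simp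
  with \<open>f \<in> Cc_plus\<close> f_le that show ?thesis by blast
qed

text \<open>
  The cone topology tests measures against compactly supported functions and the constant \<open>1\<close> only.
  For nonnegative \<open>h\<close> the integral is a supremum of integrals of compactly supported functions,
  hence lower semicontinuous. Applied to \<open>g + b\<close> and to \<open>b - g\<close>, whose integrals differ from those
  of \<open>g\<close> and \<open>- g\<close> by a continuous multiple of the total mass, this yields continuity.
\<close>

lemma continuous_map_cone_integral_real:
  fixes g :: "'k::t2_space \<Rightarrow> real"
  assumes lc: "locally_compact_space (euclidean :: 'k topology)"
    and g: "continuous_on UNIV g" "\<And>x. norm (g x) \<le> b"
  shows "continuous_map cone_topology euclidean (\<lambda>\<mu>. \<integral>x. g x \<partial>as_measure \<mu>)"
proof -
  let ?I = "\<lambda>g \<mu>. \<integral>x. g x \<partial>as_measure \<mu>"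
  have int: "integrable (as_measure \<mu>) h"
    if "\<mu> \<in> M_plus" "continuous_on UNIV h" "\<And>x. norm (h x) \<le> B" for \<mu> and h :: "'k \<Rightarrow> real" and B
    using that by (intro integrable_bounded_continuous[of _ h B] finite_measure_as_measure) (simp_all add: M_plus_iff)
  have one: "continuous_map cone_topology euclidean (\<lambda>\<mu>::'k set \<Rightarrow> complex. ?I (\<lambda>_. 1::real) \<mu>)"
    by (rule continuous_map_cone_generator) simp
  \<comment> \<open>The multiple \<open>c\<close> of the total mass is carried along to allow for the constants added to \<open>g\<close> below.\<close>
  have lsc: "openin cone_topology {\<mu> \<in> M_plus. a < ?I h \<mu> + c * ?I (\<lambda>_. 1) \<mu>}"
    if h: "continuous_on UNIV h" "\<And>x. 0 \<le> h x" "\<And>x. h x \<le> B" for h :: "'k \<Rightarrow> real" and B a c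
  proof -
    have "{\<mu> \<in> M_plus. a < ?I h \<mu> + c * ?I (\<lambda>_. 1) \<mu>}
        = (\<Union>f\<in>{f \<in> Cc_plus. \<forall>x. f x \<le> h x}. {\<mu> \<in> M_plus. a < ?I f \<mu> + c * ?I (\<lambda>_. 1) \<mu>})"
    proof (intro equalityI subsetI)
      fix \<mu> assume "\<mu> \<in> {\<mu> \<in> M_plus. a < ?I h \<mu> + c * ?I (\<lambda>_. 1) \<mu>}"
      then have \<mu>: "\<mu> \<in> M_plus" "a - c * ?I (\<lambda>_. 1) \<mu> < ?I h \<mu>" by auto
      obtain f where "f \<in> Cc_plus" "\<And>x. f x \<le> h x" "a - c * ?I (\<lambda>_. 1) \<mu> < ?I f \<mu>"
        by (rule integral_approx_from_below[OF lc \<mu>(1) h \<mu>(2)]) blast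
      with \<mu>(1) show "\<mu> \<in> (\<Union>f\<in>{f \<in> Cc_plus. \<forall>x. f x \<le> h x}. {\<mu> \<in> M_plus. a < ?I f \<mu> + c * ?I (\<lambda>_. 1) \<mu>})"
        by (intro UN_I[of f]) auto
    next
      fix \<mu> assume "\<mu> \<in> (\<Union>f\<in>{f \<in> Cc_plus. \<forall>x. f x \<le> h x}. {\<mu> \<in> M_plus. a < ?I f \<mu> + c * ?I (\<lambda>_. 1) \<mu>})"
      then obtain f where f: "f \<in> Cc_plus" "\<And>x. f x \<le> h x"
        and \<mu>: "\<mu> \<in> M_plus" "a < ?I f \<mu> + c * ?I (\<lambda>_. 1) \<mu>" by blast
      have f_nn: "0 \<le> f x" for x using f(1) by (simp add: Cc_plus_def)
      have f_cont: "continuous_on UNIV f" using f(1) by (simp add: Cc_plus_def)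
      have "?I f \<mu> \<le> ?I h \<mu>"
      proof (rule integral_mono[OF int[OF \<mu>(1) f_cont] int[OF \<mu>(1) h(1)] f(2)])
        show "norm (f x) \<le> B" for x using f_nn[of x] f(2)[of x] h(3)[of x] by simp
        show "norm (h x) \<le> B" for x using h(2,3)[of x] by simp
      qed
      with \<mu> show "\<mu> \<in> {\<mu> \<in> M_plus. a < ?I h \<mu> + c * ?I (\<lambda>_. 1) \<mu>}" by auto
    qed
    moreover have "openin cone_topology {\<mu> \<in> M_plus. a < ?I f \<mu> + c * ?I (\<lambda>_. 1) \<mu>}"
      if "f \<in> Cc_plus" for f :: "'k \<Rightarrow> real"
    proof -
      have "continuous_map cone_topology euclidean (\<lambda>\<mu>. ?I f \<mu> + c * ?I (\<lambda>_. 1) \<mu>)"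
        using that by (intro continuous_map_add continuous_map_real_mult_left one
            continuous_map_cone_generator) simp
      then show ?thesis
        by (simp add: continuous_map_upper_lower_semicontinuous_lt)
    qed
    ultimately show ?thesis by auto
  qed
  have b: "0 \<le> b" using norm_ge_zero g(2) by (rule order_trans)
  have up: "openin cone_topology {\<mu> \<in> M_plus. a < ?I g \<mu>}" for a
  proof -
    have "?I g \<mu> = ?I (\<lambda>x. g x + b) \<mu> + (- b) * ?I (\<lambda>_. 1) \<mu>" if "\<mu> \<in> M_plus" for \<mu>
      using int[OF that g] int[OF that, of "\<lambda>_. b" b] b by simp
    then have "{\<mu> \<in> M_plus. a < ?I g \<mu>}
        = {\<mu> \<in> M_plus. a < ?I (\<lambda>x. g x + b) \<mu> + (- b) * ?I (\<lambda>_. 1) \<mu>}"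
      by (intro Collect_cong conj_cong refl) simp
    also have "openin cone_topology \<dots>"
    proof (rule lsc)
      show "continuous_on UNIV (\<lambda>x. g x + b)" by (intro continuous_intros g(1))
      show "0 \<le> g x + b" "g x + b \<le> 2 * b" for x using g(2)[of x] by auto
    qed
    finally show ?thesis .
  qed
  have low: "openin cone_topology {\<mu> \<in> M_plus. ?I g \<mu> < a}" for a
  proof -
    have "?I g \<mu> = - (?I (\<lambda>x. b - g x) \<mu> + (- b) * ?I (\<lambda>_. 1) \<mu>)" if "\<mu> \<in> M_plus" for \<mu>
      using int[OF that g] int[OF that, of "\<lambda>_. b" b] b by simp
    then have "{\<mu> \<in> M_plus. ?I g \<mu> < a}
        = {\<mu> \<in> M_plus. - a < ?I (\<lambda>x. b - g x) \<mu> + (- b) * ?I (\<lambda>_. 1) \<mu>}"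
      by (intro Collect_cong conj_cong refl) (simp, linarith)
    also have "openin cone_topology \<dots>"
    proof (rule lsc)
      show "continuous_on UNIV (\<lambda>x. b - g x)" by (intro continuous_intros g(1))
      show "0 \<le> b - g x" "b - g x \<le> 2 * b" for x using g(2)[of x] by auto
    qed
    finally show ?thesis .
  qed
  show ?thesis
    unfolding continuous_map_upper_lower_semicontinuous_lt using up low by simp
qed

lemma continuous_map_cone_integral:
  fixes g :: "'k::t2_space \<Rightarrow> complex"
  assumes lc: "locally_compact_space (euclidean :: 'k topology)"
    and g: "continuous_on UNIV g" "\<And>x. norm (g x) \<le> b"
  shows "continuous_map cone_topology euclidean (\<lambda>\<mu>. \<integral>x. g x \<partial>as_measure \<mu>)"
proof -
  have bd: "norm (Re (g x)) \<le> b" "norm (Im (g x)) \<le> b" for x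
    using order_trans[OF abs_Re_le_cmod g(2)] order_trans[OF abs_Im_le_cmod g(2)] by simp_all
  have Re: "continuous_map cone_topology euclidean (\<lambda>\<mu>. \<integral>x. Re (g x) \<partial>as_measure \<mu>)"
    by (rule continuous_map_cone_integral_real[OF lc continuous_on_Re[OF g(1)] bd(1)])
  have Im: "continuous_map cone_topology euclidean (\<lambda>\<mu>. \<integral>x. Im (g x) \<partial>as_measure \<mu>)"
    by (rule continuous_map_cone_integral_real[OF lc continuous_on_Im[OF g(1)] bd(2)])
  have post: "continuous_map cone_topology euclidean (\<lambda>\<mu>. complex_of_real (h \<mu>) * z)"
    if "continuous_map cone_topology euclidean h" for h :: "('k set \<Rightarrow> complex) \<Rightarrow> real" and z
  proof -
    have "continuous_map euclidean euclidean (\<lambda>r. complex_of_real r * z)"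
      by (simp add: continuous_intros)
    from continuous_map_compose[OF that this] show ?thesis by (simp add: o_def)
  qed
  have "continuous_map cone_topology euclidean
      (\<lambda>\<mu>. complex_of_real (\<integral>x. Re (g x) \<partial>as_measure \<mu>) * 1 + complex_of_real (\<integral>x. Im (g x) \<partial>as_measure \<mu>) * \<i>)"
    by (intro continuous_map_add post Re Im)
  then show ?thesis
  proof (rule continuous_map_eq)
    fix \<mu> :: "'k set \<Rightarrow> complex" assume "\<mu> \<in> topspace cone_topology"
    then have "integrable (as_measure \<mu>) g"
      by (intro integrable_bounded_continuous[OF finite_measure_as_measure _ g]) (simp_all add: M_plus_iff)
    then show "complex_of_real (\<integral>x. Re (g x) \<partial>as_measure \<mu>) * 1 + complex_of_real (\<integral>x. Im (g x) \<partial>as_measure \<mu>) * \<i>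
        = (\<integral>x. g x \<partial>as_measure \<mu>)" by (simp add: complex_eq_iff)
  qed
qed

text \<open>
  A compact set carrying almost all of the mass is covered by finitely many open sets on each of
  which all functions of \<open>G\<close> vary little. Made disjoint, these sets give a simple function close to
  each \<open>g \<in> G\<close>; its integral is a finite sum of values of \<open>g\<close> with weights that do not depend
  on \<open>g\<close>.
\<close>

lemma discrete_approximation:
  fixes \<mu> :: "'k::t2_space set \<Rightarrow> complex" and G :: "('k \<Rightarrow> complex) set"
  assumes \<mu>: "\<mu> \<in> M_plus" and "finite G" and cont: "\<And>g. g \<in> G \<Longrightarrow> continuous_on UNIV g"
    and bdd: "\<And>g x. g \<in> G \<Longrightarrow> norm (g x) \<le> b" and "0 < e"
  obtains n :: nat and c :: "nat \<Rightarrow> real" and w where "\<And>i. 0 \<le> c i"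
    "\<And>g. g \<in> G \<Longrightarrow> norm ((\<integral>x. g x \<partial>as_measure \<mu>) - (\<Sum>i<n. of_real (c i) * g (w i))) < e"
proof -
  let ?M = "as_measure \<mu>"
  have pos: "positive_borel_measure \<mu>" using \<mu> by (simp add: M_plus_iff)
  interpret finite_measure ?M by (rule finite_measure_as_measure[OF pos])
  define B where "B = \<bar>b\<bar> + 1"
  have B: "0 < B" by (simp add: B_def)
  have bdd': "norm (g x) \<le> B" if "g \<in> G" for g x
    using bdd[OF that, of x] unfolding B_def by linarith
  define K where "K = measure ?M UNIV + 1"
  define \<eta> where "\<eta> = e / (2 * K)"
  have m: "0 < K" unfolding K_def using measure_nonneg[of ?M UNIV] by linarith
  then have \<eta>: "0 < \<eta>" using \<open>0 < e\<close> by (simp add: \<eta>_def)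
  have "0 < e / (2 * B)" using \<open>0 < e\<close> B by simp
  then obtain C where C: "compact C" "measure ?M (- C) < e / (2 * B)"
    by (rule M_plus_inner_regular[OF \<mu>]) blast
  define U where "U w = {x. \<forall>g\<in>G. dist (g x) (g w) < \<eta>}" for w
  have U_open: "open (U w)" for w
  proof -
    have "U w = (\<Inter>g\<in>G. {x. dist (g x) (g w) < \<eta>})" by (auto simp: U_def)
    also have "open \<dots>"
      using \<open>finite G\<close> by (intro open_INT ballI open_Collect_less continuous_intros cont) auto
    finally show ?thesis .
  qed
  obtain D where D: "finite D" "C \<subseteq> (\<Union>w\<in>D. U w)"
  proof (rule compactE_image[OF C(1), of C U])
    have "x \<in> U x" for x using \<eta> by (simp add: U_def)
    then show "C \<subseteq> (\<Union>w\<in>C. U w)" by blast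
  qed (rule U_open)
  obtain w where w: "bij_betw w {0..<card D} D"
    using ex_bij_betw_nat_finite[OF D(1)] by blast
  define n where "n = card D"
  have D_eq: "D = w ` {..<n}" using w by (simp add: bij_betw_def n_def atLeast0LessThan)
  define E where "E i = C \<inter> disjointed (\<lambda>i. U (w i)) i" for i
  have Cb: "C \<in> sets borel" using compact_imp_closed[OF C(1)] by (rule borel_closed)
  have E_sets: "E i \<in> sets borel" for i
  proof -
    have "range (\<lambda>i. U (w i)) \<subseteq> sets borel" using U_open by (auto intro: borel_open)
    then have "disjointed (\<lambda>i. U (w i)) i \<in> sets borel"
      using sets.range_disjointed_sets by blast
    then show ?thesis using Cb by (simp add: E_def)
  qed
  have E_disj: "i = j" if "x \<in> E i" "x \<in> E j" for x i j
    using that disjoint_family_disjointed[of "\<lambda>i. U (w i)"] unfolding E_def disjoint_family_on_def by blast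
  have E_cover: "\<exists>i<n. x \<in> E i" if x: "x \<in> C" for x
  proof -
    have "x \<in> (\<Union>i\<in>{0..<n}. U (w i))" using D(2) x by (auto simp: D_eq atLeast0LessThan)
    also have "\<dots> = (\<Union>i\<in>{0..<n}. disjointed (\<lambda>i. U (w i)) i)" by (rule finite_UN_disjointed_eq[symmetric])
    finally show ?thesis using x by (auto simp: E_def)
  qed
  show ?thesis
  proof (rule that[where n = n and c = "\<lambda>i. measure ?M (E i)" and w = w])
    fix g assume g: "g \<in> G"
    define S where "S x = (\<Sum>i<n. indicator (E i) x *\<^sub>R g (w i))" for x
    have int_g: "integrable ?M g"
      by (rule integrable_bounded_continuous[OF finite_measure_axioms _ cont[OF g] bdd'[OF g]]) simp
    have int_ind: "integrable ?M (\<lambda>x. indicator (E i) x *\<^sub>R g (w i))" for i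
      using E_sets by (intro integrable_indicator) (simp_all add: less_top[symmetric])
    then have int_S: "integrable ?M S" unfolding S_def by (rule Bochner_Integration.integrable_sum)
    have "(\<integral>x. S x \<partial>?M) = (\<Sum>i<n. (\<integral>x. indicator (E i) x *\<^sub>R g (w i) \<partial>?M))"
      unfolding S_def by (rule Bochner_Integration.integral_sum[OF int_ind])
    also have "\<dots> = (\<Sum>i<n. of_real (measure ?M (E i)) * g (w i))"
      using E_sets by (intro sum.cong refl) (simp add: scaleR_conv_of_real)
    finally have S_int: "(\<integral>x. S x \<partial>?M) = (\<Sum>i<n. of_real (measure ?M (E i)) * g (w i))" .
    have Cs: "- C \<in> sets ?M" using Cb by simp
    then have ind: "integrable ?M (indicator (- C) :: 'k \<Rightarrow> real)"
      by (intro integrable_real_indicator) (simp_all add: less_top[symmetric])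
    have bound: "norm (g x - S x) \<le> \<eta> + B * indicator (- C) x" for x
    proof (cases "x \<in> C")
      case True
      then obtain i where i: "i < n" "x \<in> E i" using E_cover by blast
      have "indicator (E j) x *\<^sub>R g (w j) = (if j = i then g (w i) else 0)" for j
      proof (cases "j = i")
        case False
        then have "x \<notin> E j" using E_disj[OF i(2)] by metis
        then show ?thesis using False by simp
      qed (use i(2) in simp)
      then have "S x = g (w i)" using i(1) by (simp add: S_def)
      moreover have "x \<in> U (w i)"
        using i(2) subsetD[OF disjointed_subset[of "\<lambda>i. U (w i)" i]] by (simp add: E_def)
      then have "norm (g x - g (w i)) < \<eta>" using g by (simp add: U_def dist_norm)
      ultimately show ?thesis using True by simp
    next
      case False
      then have "S x = 0" by (simp add: S_def E_def)
      then show ?thesis using False bdd'[OF g, of x] \<eta> by simp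
    qed
    have "norm ((\<integral>x. g x \<partial>?M) - (\<integral>x. S x \<partial>?M)) = norm (\<integral>x. g x - S x \<partial>?M)"
      using int_g int_S by simp
    also have "\<dots> \<le> (\<integral>x. norm (g x - S x) \<partial>?M)" by (rule integral_norm_bound)
    also have "\<dots> \<le> (\<integral>x. \<eta> + B * indicator (- C) x \<partial>?M)"
    proof (intro integral_mono bound)
      show "integrable ?M (\<lambda>x. norm (g x - S x))" using int_g int_S by simp
      show "integrable ?M (\<lambda>x. \<eta> + B * indicator (- C) x)" using Cs ind by simp
    qed
    also have "\<dots> = \<eta> * measure ?M UNIV + B * measure ?M (- C)"
      using Cs ind by simp
    also have "\<dots> < e / 2 + e / 2"
    proof (rule add_le_less_mono)
      have "\<eta> * measure ?M UNIV \<le> \<eta> * K" using \<eta> by (intro mult_left_mono) (auto simp: K_def)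
      also have "\<dots> = e / 2" using m by (simp add: \<eta>_def)
      finally show "\<eta> * measure ?M UNIV \<le> e / 2" .
      show "B * measure ?M (- C) < e / 2" using C(2) B by (simp add: field_simps)
    qed
    finally show "norm ((\<integral>x. g x \<partial>?M) - (\<Sum>i<n. of_real (measure ?M (E i)) * g (w i))) < e"
      by (simp add: S_int)
  qed simp
qed


section \<open>Convolution and iterated integrals\<close>

lemma integral_norm_le_prob:
  fixes g :: "'k::t2_space \<Rightarrow> complex"
  assumes M: "prob_space M" and sets: "sets M = sets borel"
    and g: "continuous_on UNIV g" "\<And>x. norm (g x) \<le> b"
  shows "norm (\<integral>x. g x \<partial>M) \<le> b"
proof -
  interpret prob_space M by fact
  have int: "integrable M g" by (rule integrable_bounded_continuous[OF finite_measure_axioms sets g])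
  have "norm (\<integral>x. g x \<partial>M) \<le> (\<integral>x. norm (g x) \<partial>M)" by (rule integral_norm_bound)
  also have "\<dots> \<le> (\<integral>x. b \<partial>M)" using int g(2) by (intro integral_mono) simp_all
  also have "\<dots> = b" by (simp add: prob_space)
  finally show ?thesis .
qed

text \<open>
  The map \<open>\<Theta>\<close> stands for convolution with a fixed point mass from one side. Both integrals agree
  when \<open>\<mu>\<close> is discrete. The left one is continuous in \<open>\<mu>\<close> for the cone topology, the right one is
  the integral of the fixed bounded continuous function \<open>h\<close>, and \<open>\<mu>\<close> can be approximated by a
  discrete measure in a prescribed cone neighbourhood and with respect to \<open>h\<close> at the same time.
\<close>

lemma
  fixes \<Theta> :: "('k::t2_space set \<Rightarrow> complex) \<Rightarrow> 'k set \<Rightarrow> complex" and g :: "'k \<Rightarrow> complex"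
  assumes lc: "locally_compact_space (euclidean :: 'k topology)"
    and \<Theta>: "continuous_map cone_topology cone_topology \<Theta>"
    and lin: "\<And>n c w. (\<And>i. 0 \<le> c i) \<Longrightarrow>
      \<Theta> (discrete_measure n c w) = (\<lambda>A. \<Sum>i<n. of_real (c i) * \<Theta> (point_mass (w i)) A)"
    and prob: "\<And>w. prob_space (as_measure (\<Theta> (point_mass w)))"
    and g: "continuous_on UNIV g" "\<And>x. norm (g x) \<le> b"
  shows continuous_on_integral_image: "continuous_on UNIV (\<lambda>w. \<integral>x. g x \<partial>as_measure (\<Theta> (point_mass w)))"
    and integral_image_eq_iterated: "\<mu> \<in> M_plus \<Longrightarrow>
      (\<integral>x. g x \<partial>as_measure (\<Theta> \<mu>)) = (\<integral>w. (\<integral>x. g x \<partial>as_measure (\<Theta> (point_mass w))) \<partial>as_measure \<mu>)"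
proof -
  let ?I = "\<lambda>\<nu>. \<integral>x. g x \<partial>as_measure (\<Theta> \<nu>)"
  define h where "h w = ?I (point_mass w)" for w
  have \<Theta>M: "\<Theta> \<nu> \<in> M_plus" if "\<nu> \<in> M_plus" for \<nu>
    using \<Theta> that by (auto simp: continuous_map_def)
  have I: "continuous_map cone_topology euclidean ?I"
    using continuous_map_compose[OF \<Theta> continuous_map_cone_integral[OF lc g]] by (simp add: o_def)
  have "continuous_map euclidean euclidean h"
    using continuous_map_compose[OF continuous_map_point_mass I] by (simp add: o_def h_def[abs_def])
  then have h_cont: "continuous_on UNIV h" by simp
  then show "continuous_on UNIV (\<lambda>w. ?I (point_mass w))" by (simp add: h_def[abs_def])
  have h_bdd: "norm (h w) \<le> b" for w
    unfolding h_def by (rule integral_norm_le_prob[OF prob _ g]) simp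
  assume \<mu>: "\<mu> \<in> M_plus"
  have main: "norm (?I \<mu> - (\<integral>w. h w \<partial>as_measure \<mu>)) \<le> 2 * e" if "0 < e" for e
  proof -
    let ?W = "{\<nu> \<in> topspace cone_topology. ?I \<nu> \<in> ball (?I \<mu>) e}"
    have W: "openin cone_topology ?W"
      using I by (rule openin_continuous_map_preimage) simp
    have "\<mu> \<in> ?W" using \<mu> \<open>0 < e\<close> by simp
    from W this obtain F d where F: "finite F" "F \<subseteq> Cc_plus \<union> {\<lambda>_. 1}" "0 < d"
      "\<And>\<nu>. \<nu> \<in> M_plus \<Longrightarrow> (\<And>f. f \<in> F \<Longrightarrow> \<bar>(\<integral>x. f x \<partial>as_measure \<nu>) - (\<integral>x. f x \<partial>as_measure \<mu>)\<bar> < d) \<Longrightarrow> \<nu> \<in> ?W"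
      by (rule cone_neighbourhood_base) blast
    \<comment> \<open>The discrete measure has to be close to \<open>\<mu>\<close> when tested against \<open>h\<close> and against the functions
      that define the neighbourhood \<open>?W\<close>.\<close>
    define G where "G = insert h ((\<lambda>f x. complex_of_real (f x)) ` F)"
    have "\<forall>f\<in>F. \<exists>B. \<forall>x. norm (f x) \<le> B" using cone_generator_properties(2) F(2) by blast
    from bchoice[OF this] obtain B where B: "\<forall>f\<in>F. \<forall>x. norm (f x) \<le> B f" by blast
    define K where "K = Max (insert b (B ` F))"
    have K: "norm (k x) \<le> K" if "k \<in> G" for k x
    proof (cases "k = h")
      case True
      have "b \<le> K" unfolding K_def using F(1) by (intro Max_ge) auto
      with True show ?thesis using h_bdd[of x] by simp
    next
      case False
      then obtain f where f: "f \<in> F" "k = (\<lambda>x. complex_of_real (f x))" using \<open>k \<in> G\<close> unfolding G_def by blast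
      have "B f \<le> K" unfolding K_def using F(1) f(1) by (intro Max_ge) auto
      moreover have "norm (f x) \<le> B f" using B f(1) by blast
      ultimately show ?thesis using f(2) by simp
    qed
    have cont: "continuous_on UNIV k" if "k \<in> G" for k
      using that h_cont cone_generator_properties(1) F(2) unfolding G_def by (auto intro!: continuous_on_of_real)
    have fin: "finite G" using F(1) by (simp add: G_def)
    have e': "0 < min d e" using F(3) \<open>0 < e\<close> by simp
    obtain n :: nat and c w where c: "\<And>i. 0 \<le> c i"
      and approx: "\<And>k. k \<in> G \<Longrightarrow>
        norm ((\<integral>x. k x \<partial>as_measure \<mu>) - (\<Sum>i<n. of_real (c i) * k (w i))) < min d e"
      by (rule discrete_approximation[where G = G and b = K and e = "min d e", OF \<mu> fin _ _ e'])
         (use cont K in blast)+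
    let ?d = "discrete_measure n c w"
    have d: "?d \<in> M_plus" using c by (rule discrete_measure_M_plus)
    have int_d: "(\<integral>x. k x \<partial>as_measure ?d) = (\<Sum>i<n. of_real (c i) * k (w i))" if "k \<in> G" for k
      using integral_M_plus_combination[of c "\<lambda>i. point_mass (w i)" n, OF c point_mass_M_plus _ cont[OF that] K[OF that]] d
      by (simp add: discrete_measure_def integral_point_mass[OF cont[OF that]])
    have "?d \<in> ?W"
    proof (rule F(4)[OF d])
      fix f assume f: "f \<in> F"
      let ?k = "\<lambda>x. complex_of_real (f x)"
      have k: "?k \<in> G" using f by (simp add: G_def)
      have "norm ((\<integral>x. ?k x \<partial>as_measure \<mu>) - (\<integral>x. ?k x \<partial>as_measure ?d)) < d"
        using approx[OF k] unfolding int_d[OF k] by simp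
      then have "norm (complex_of_real ((\<integral>x. f x \<partial>as_measure \<mu>) - (\<integral>x. f x \<partial>as_measure ?d))) < d"
        by simp
      then show "\<bar>(\<integral>x. f x \<partial>as_measure ?d) - (\<integral>x. f x \<partial>as_measure \<mu>)\<bar> < d"
        unfolding norm_of_real by (simp add: abs_minus_commute)
    qed
    moreover have "?I ?d = (\<Sum>i<n. of_real (c i) * h (w i))"
      using integral_M_plus_combination[of c "\<lambda>i. \<Theta> (point_mass (w i))" n, OF c \<Theta>M[OF point_mass_M_plus] _ g]
        \<Theta>M[OF d] by (simp add: lin[OF c] h_def)
    ultimately have "norm (?I \<mu> - (\<Sum>i<n. of_real (c i) * h (w i))) < e"
      by (simp add: dist_norm)
    moreover have "norm ((\<integral>w. h w \<partial>as_measure \<mu>) - (\<Sum>i<n. of_real (c i) * h (w i))) < e"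
      using approx[of h] by (simp add: G_def)
    ultimately show ?thesis
      using norm_triangle_ineq4[of "?I \<mu> - (\<Sum>i<n. of_real (c i) * h (w i))"
          "(\<integral>w. h w \<partial>as_measure \<mu>) - (\<Sum>i<n. of_real (c i) * h (w i))"] by simp
  qed
  have "norm (?I \<mu> - (\<integral>w. h w \<partial>as_measure \<mu>)) \<le> 0"
  proof (rule field_le_epsilon)
    fix e :: real assume "0 < e"
    then show "norm (?I \<mu> - (\<integral>w. h w \<partial>as_measure \<mu>)) \<le> 0 + e" using main[of "e / 2"] by simp
  qed
  then show "?I \<mu> = (\<integral>w. ?I (point_mass w) \<partial>as_measure \<mu>)" by (simp add: h_def)
qed

section \<open>Translations on a semitopological semihypergroup\<close>

context semitopological_semihypergroup
begin

text \<open>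
  The translation operators as maps of the normed space of bounded continuous functions to itself.
  By the continuity of convolution every translate is again bounded and continuous, so that
  \<open>Bcontfun\<close> loses nothing; this is \<open>apply_left_shift\<close> and \<open>apply_right_shift\<close> below.
\<close>

definition left_shift :: "'k \<Rightarrow> ('k \<Rightarrow>\<^sub>C complex) \<Rightarrow> ('k \<Rightarrow>\<^sub>C complex)" where
  "left_shift x f = Bcontfun (left_translate conv x f)"

definition right_shift :: "'k \<Rightarrow> ('k \<Rightarrow>\<^sub>C complex) \<Rightarrow> ('k \<Rightarrow>\<^sub>C complex)" where
  "right_shift y f = Bcontfun (right_translate conv y f)"

lemma M_plus_conv: "conv (point_mass x) (point_mass y) \<in> M_plus"
  by (intro conv_M_plus point_mass_M_plus)

lemma discrete_measure_M_space: "(\<And>i. 0 \<le> c i) \<Longrightarrow> discrete_measure n c w \<in> M_space"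
  for w :: "nat \<Rightarrow> 'k"
  by (intro M_plus_subset_M_space discrete_measure_M_plus)

lemma point_mass_M_space: "point_mass x \<in> M_space" for x :: 'k
  by (rule M_plus_subset_M_space[OF point_mass_M_plus])

lemma conv_discrete_right:
  assumes c: "\<And>i. 0 \<le> c i" and \<omega>: "\<omega> \<in> M_space"
  shows "conv \<omega> (discrete_measure n c w) = (\<lambda>A. \<Sum>i<n. of_real (c i) * conv \<omega> (point_mass (w i)) A)"
proof (induction n)
  case 0
  \<comment> \<open>The zero measure is a multiple of a point mass; any point serves.\<close>
  have "conv \<omega> (\<lambda>A. 0 * point_mass (w 0) A) = (\<lambda>A. 0 * conv \<omega> (point_mass (w 0)) A)"
    by (rule conv_scale_right[OF \<omega> point_mass_M_space])
  then show ?case by (simp add: discrete_measure_def)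
next
  case (Suc n)
  let ?p = "\<lambda>A. of_real (c n) * point_mass (w n) A"
  have "?p = discrete_measure 1 (\<lambda>_. c n) (\<lambda>_. w n)" by (simp add: discrete_measure_def)
  then have p: "?p \<in> M_space" using discrete_measure_M_space[of "\<lambda>_. c n"] c by simp
  have "conv \<omega> (discrete_measure (Suc n) c w) = conv \<omega> (\<lambda>A. discrete_measure n c w A + ?p A)"
    by (simp add: discrete_measure_def)
  also have "\<dots> = (\<lambda>A. conv \<omega> (discrete_measure n c w) A + conv \<omega> ?p A)"
    by (rule conv_add_right[OF discrete_measure_M_space[OF c] p \<omega>])
  also have "conv \<omega> ?p = (\<lambda>A. of_real (c n) * conv \<omega> (point_mass (w n)) A)"
    by (rule conv_scale_right[OF \<omega> point_mass_M_space])
  finally show ?case by (simp add: Suc.IH)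
qed

lemma conv_discrete_left:
  assumes c: "\<And>i. 0 \<le> c i" and \<omega>: "\<omega> \<in> M_space"
  shows "conv (discrete_measure n c w) \<omega> = (\<lambda>A. \<Sum>i<n. of_real (c i) * conv (point_mass (w i)) \<omega> A)"
proof (induction n)
  case 0
  have "conv (\<lambda>A. 0 * point_mass (w 0) A) \<omega> = (\<lambda>A. 0 * conv (point_mass (w 0)) \<omega> A)"
    by (rule conv_scale_left[OF point_mass_M_space \<omega>])
  then show ?case by (simp add: discrete_measure_def)
next
  case (Suc n)
  let ?p = "\<lambda>A. of_real (c n) * point_mass (w n) A"
  have "?p = discrete_measure 1 (\<lambda>_. c n) (\<lambda>_. w n)" by (simp add: discrete_measure_def)
  then have p: "?p \<in> M_space" using discrete_measure_M_space[of "\<lambda>_. c n"] c by simp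
  have "conv (discrete_measure (Suc n) c w) \<omega> = conv (\<lambda>A. discrete_measure n c w A + ?p A) \<omega>"
    by (simp add: discrete_measure_def)
  also have "\<dots> = (\<lambda>A. conv (discrete_measure n c w) \<omega> A + conv ?p \<omega> A)"
    by (rule conv_add_left[OF discrete_measure_M_space[OF c] p \<omega>])
  also have "conv ?p \<omega> = (\<lambda>A. of_real (c n) * conv (point_mass (w n)) \<omega> A)"
    by (rule conv_scale_left[OF point_mass_M_space \<omega>])
  finally show ?case by (simp add: Suc.IH)
qed

lemma
  fixes f :: "'k \<Rightarrow>\<^sub>C complex"
  shows continuous_on_integral_conv_right:
      "continuous_on UNIV (\<lambda>w. \<integral>z. f z \<partial>as_measure (conv (point_mass x) (point_mass w)))"
    and integral_conv_right: "\<mu> \<in> M_plus \<Longrightarrow>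
      (\<integral>z. f z \<partial>as_measure (conv (point_mass x) \<mu>)) = (\<integral>w. (\<integral>z. f z \<partial>as_measure (conv (point_mass x) (point_mass w))) \<partial>as_measure \<mu>)"
proof -
  note facts = locally_compact conv_continuous_right[OF point_mass_M_plus]
    conv_discrete_right[OF _ point_mass_M_space, rule_format]
    conv_point_mass_prob continuous_on_apply_bcontfun[of UNIV f] norm_bounded
  show "continuous_on UNIV (\<lambda>w. \<integral>z. f z \<partial>as_measure (conv (point_mass x) (point_mass w)))"
    by (rule continuous_on_integral_image[OF facts]) blast
  show "(\<integral>z. f z \<partial>as_measure (conv (point_mass x) \<mu>)) = (\<integral>w. (\<integral>z. f z \<partial>as_measure (conv (point_mass x) (point_mass w))) \<partial>as_measure \<mu>)"
    if "\<mu> \<in> M_plus"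
    by (rule integral_image_eq_iterated[OF facts]) (blast, rule that)
qed

lemma
  fixes f :: "'k \<Rightarrow>\<^sub>C complex"
  shows continuous_on_integral_conv_left:
      "continuous_on UNIV (\<lambda>w. \<integral>z. f z \<partial>as_measure (conv (point_mass w) (point_mass x)))"
    and integral_conv_left: "\<mu> \<in> M_plus \<Longrightarrow>
      (\<integral>z. f z \<partial>as_measure (conv \<mu> (point_mass x))) = (\<integral>w. (\<integral>z. f z \<partial>as_measure (conv (point_mass w) (point_mass x))) \<partial>as_measure \<mu>)"
proof -
  note facts = locally_compact conv_continuous_left[OF point_mass_M_plus]
    conv_discrete_left[OF _ point_mass_M_space, rule_format]
    conv_point_mass_prob continuous_on_apply_bcontfun[of UNIV f] norm_bounded
  show "continuous_on UNIV (\<lambda>w. \<integral>z. f z \<partial>as_measure (conv (point_mass w) (point_mass x)))"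
    by (rule continuous_on_integral_image[OF facts]) blast
  show "(\<integral>z. f z \<partial>as_measure (conv \<mu> (point_mass x))) = (\<integral>w. (\<integral>z. f z \<partial>as_measure (conv (point_mass w) (point_mass x))) \<partial>as_measure \<mu>)"
    if "\<mu> \<in> M_plus"
    by (rule integral_image_eq_iterated[OF facts]) (blast, rule that)
qed

lemma eval_product_le: "cmod (eval_product conv f x y) \<le> norm f" for f :: "'k \<Rightarrow>\<^sub>C complex"
  unfolding eval_product_def
  by (rule integral_norm_le_prob[OF conv_point_mass_prob _ continuous_on_apply_bcontfun norm_bounded]) simp

lemma apply_left_shift: "left_shift x f y = eval_product conv f x y"
  for f :: "'k \<Rightarrow>\<^sub>C complex"
  unfolding left_shift_def left_translate_def
  by (rule Bcontfun_apply[OF _ eval_product_le])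
     (simp add: eval_product_def continuous_on_integral_conv_right)

lemma apply_right_shift: "right_shift x f y = eval_product conv f y x"
  for f :: "'k \<Rightarrow>\<^sub>C complex"
  unfolding right_shift_def right_translate_def
  by (rule Bcontfun_apply[OF _ eval_product_le])
     (simp add: eval_product_def continuous_on_integral_conv_left)

lemma left_shift_right_shift: "left_shift x f y = right_shift y f x"
  for f :: "'k \<Rightarrow>\<^sub>C complex"
  by (simp add: apply_left_shift apply_right_shift)

lemma norm_left_shift_le: "norm (left_shift x f) \<le> norm f"
  for f :: "'k \<Rightarrow>\<^sub>C complex"
  by (rule norm_bound) (simp add: apply_left_shift eval_product_le)

lemma norm_right_shift_le: "norm (right_shift x f) \<le> norm f"
  for f :: "'k \<Rightarrow>\<^sub>C complex"
  by (rule norm_bound) (simp add: apply_right_shift eval_product_le)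

lemma left_translate_eq: "left_translate conv x f = left_shift x f"
  for f :: "'k \<Rightarrow>\<^sub>C complex"
  by (rule ext) (simp add: apply_left_shift left_translate_def)

lemma right_translate_eq: "right_translate conv x f = right_shift x f"
  for f :: "'k \<Rightarrow>\<^sub>C complex"
  by (rule ext) (simp add: apply_right_shift right_translate_def)

lemma integrable_conv: "integrable (as_measure (conv (point_mass x) (point_mass y))) (apply_bcontfun f)"
  for f :: "'k \<Rightarrow>\<^sub>C complex"
  using M_plus_conv[of x y]
  by (intro integrable_bounded_continuous[OF _ _ continuous_on_apply_bcontfun norm_bounded] finite_measure_as_measure)
     (simp_all add: M_plus_iff)

lemma eval_product_add: "eval_product conv (\<lambda>z. f z + g z) x y = eval_product conv f x y + eval_product conv g x y"
  for f g :: "'k \<Rightarrow>\<^sub>C complex"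
  by (simp add: eval_product_def integrable_conv)

lemma eval_product_scale: "eval_product conv (apply_bcontfun (scaleC_bcontfun c f)) x y = c * eval_product conv f x y"
  for f :: "'k \<Rightarrow>\<^sub>C complex"
  by (simp add: eval_product_def)

lemma eval_product_diff: "eval_product conv (\<lambda>z. f z - g z) x y = eval_product conv f x y - eval_product conv g x y"
  for f g :: "'k \<Rightarrow>\<^sub>C complex"
  by (simp add: eval_product_def integrable_conv)

lemma left_shift_add: "left_shift x (f + g) = left_shift x f + left_shift x g"
  for f g :: "'k \<Rightarrow>\<^sub>C complex"
  by (rule bcontfun_eqI) (simp add: apply_left_shift eval_product_add)

lemma left_shift_scale: "left_shift x (scaleC_bcontfun c f) = scaleC_bcontfun c (left_shift x f)"
  for f :: "'k \<Rightarrow>\<^sub>C complex"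
  by (rule bcontfun_eqI) (simp add: apply_left_shift eval_product_scale)

lemma left_shift_diff: "left_shift x (f - g) = left_shift x f - left_shift x g"
  for f g :: "'k \<Rightarrow>\<^sub>C complex"
  by (rule bcontfun_eqI) (simp add: apply_left_shift eval_product_diff)

lemma right_shift_diff: "right_shift x (f - g) = right_shift x f - right_shift x g"
  for f g :: "'k \<Rightarrow>\<^sub>C complex"
  by (rule bcontfun_eqI) (simp add: apply_right_shift eval_product_diff)

text \<open>
  Both sides are \<open>f (x * y * z)\<close>: the left one bracketed as \<open>x * (y * z)\<close>, the right one as
  \<open>(x * y) * z\<close>.
\<close>

lemma left_shift_left_shift: "left_shift y (left_shift x f) z = (\<integral>w. right_shift z f w \<partial>as_measure (conv (point_mass x) (point_mass y)))"
  for f :: "'k \<Rightarrow>\<^sub>C complex"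
proof -
  have "left_shift y (left_shift x f) z = (\<integral>w. (\<integral>v. f v \<partial>as_measure (conv (point_mass x) (point_mass w)))
      \<partial>as_measure (conv (point_mass y) (point_mass z)))"
    by (simp add: apply_left_shift eval_product_def)
  also have "\<dots> = (\<integral>v. f v \<partial>as_measure (conv (point_mass x) (conv (point_mass y) (point_mass z))))"
    by (rule integral_conv_right[symmetric]) (rule M_plus_conv)
  also have "\<dots> = (\<integral>v. f v \<partial>as_measure (conv (conv (point_mass x) (point_mass y)) (point_mass z)))"
    by (simp add: conv_assoc point_mass_M_space)
  also have "\<dots> = (\<integral>w. (\<integral>v. f v \<partial>as_measure (conv (point_mass w) (point_mass z)))
      \<partial>as_measure (conv (point_mass x) (point_mass y)))"
    by (rule integral_conv_left) (rule M_plus_conv)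
  also have "\<dots> = (\<integral>w. right_shift z f w \<partial>as_measure (conv (point_mass x) (point_mass y)))"
    by (simp add: apply_right_shift eval_product_def)
  finally show ?thesis .
qed

lemma right_shift_left_shift_commute: "right_shift y (left_shift x f) = left_shift x (right_shift y f)"
  for f :: "'k \<Rightarrow>\<^sub>C complex"
proof (rule bcontfun_eqI)
  fix z
  have "right_shift y (left_shift x f) z = left_shift z (left_shift x f) y" by (simp add: left_shift_right_shift)
  also have "\<dots> = (\<integral>w. right_shift y f w \<partial>as_measure (conv (point_mass x) (point_mass z)))" by (rule left_shift_left_shift)
  also have "\<dots> = left_shift x (right_shift y f) z" by (simp add: apply_left_shift eval_product_def)
  finally show "right_shift y (left_shift x f) z = left_shift x (right_shift y f) z" .
qed

lemma AP_l_iff: "f \<in> AP_l conv \<longleftrightarrow> totally_bounded_family (\<lambda>x. left_shift x f)"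
proof -
  have "range (\<lambda>x. apply_bcontfun (left_shift x f)) \<subseteq> bcontfun" by (auto simp: apply_bcontfun)
  moreover have "Bcontfun ` range (\<lambda>x. apply_bcontfun (left_shift x f)) = range (\<lambda>x. left_shift x f)"
    by (simp add: image_image apply_bcontfun_inverse)
  ultimately show ?thesis
    by (simp add: AP_l_def relatively_compact_in_C_def left_translate_eq compact_closure_range_iff[OF complete_UNIV_bcontfun])
qed

lemma AP_r_iff: "f \<in> AP_r conv \<longleftrightarrow> totally_bounded_family (\<lambda>x. right_shift x f)"
proof -
  have "range (\<lambda>x. apply_bcontfun (right_shift x f)) \<subseteq> bcontfun" by (auto simp: apply_bcontfun)
  moreover have "Bcontfun ` range (\<lambda>x. apply_bcontfun (right_shift x f)) = range (\<lambda>x. right_shift x f)"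
    by (simp add: image_image apply_bcontfun_inverse)
  ultimately show ?thesis
    by (simp add: AP_r_def relatively_compact_in_C_def right_translate_eq compact_closure_range_iff[OF complete_UNIV_bcontfun])
qed

text \<open>
  One of the two conditions defining almost periodicity implies the other, as left and right
  translates are the rows and columns of the kernel \<open>f (x * y)\<close>.
\<close>

lemma AP_iff_left_shift: "f \<in> AP conv \<longleftrightarrow> totally_bounded_family (\<lambda>x. left_shift x f)"
  using totally_bounded_family_transpose[of "\<lambda>x. left_shift x f" "\<lambda>x. right_shift x f"]
  by (auto simp: AP_def AP_l_iff AP_r_iff left_shift_right_shift)

lemma AP_iff_right_shift: "f \<in> AP conv \<longleftrightarrow> totally_bounded_family (\<lambda>x. right_shift x f)"
  using totally_bounded_family_transpose[of "\<lambda>x. right_shift x f" "\<lambda>x. left_shift x f"]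
  by (auto simp: AP_def AP_l_iff AP_r_iff left_shift_right_shift)

lemma AP_add: "f \<in> AP conv \<Longrightarrow> g \<in> AP conv \<Longrightarrow> f + g \<in> AP conv"
  unfolding AP_iff_left_shift left_shift_add by (rule totally_bounded_family_add)

lemma AP_scale: "f \<in> AP conv \<Longrightarrow> scaleC_bcontfun c f \<in> AP conv"
  unfolding AP_iff_left_shift left_shift_scale
proof (erule totally_bounded_family_Lipschitz[where C = "cmod c"])
  fix x y
  have "scaleC_bcontfun c (left_shift x f) - scaleC_bcontfun c (left_shift y f) = scaleC_bcontfun c (left_shift x f - left_shift y f)"
    by (rule bcontfun_eqI) (simp add: algebra_simps)
  then show "dist (scaleC_bcontfun c (left_shift x f)) (scaleC_bcontfun c (left_shift y f)) \<le> cmod c * dist (left_shift x f) (left_shift y f)"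
    using norm_scaleC_bcontfun_le[of c "left_shift x f - left_shift y f"] by (simp add: dist_norm)
qed

lemma scaleC_minus_one: "scaleC_bcontfun (- 1) f = - f"
  by (rule bcontfun_eqI) simp

lemma AP_diff: "f \<in> AP conv \<Longrightarrow> g \<in> AP conv \<Longrightarrow> f - g \<in> AP conv"
  using AP_add[of f "- g"] AP_scale[of g "- 1"] by (simp add: scaleC_minus_one)

text \<open>
  Right translates of \<open>left_shift x f\<close> are images of right translates of \<open>f\<close> under the contraction
  \<open>left_shift x\<close>. Testing almost periodicity with right translates is what makes this short: left
  translates of \<open>left_shift x f\<close> are averages of left translates of \<open>f\<close>.
\<close>

lemma AP_left_shift:
  assumes "f \<in> AP conv"
  shows "left_shift x f \<in> AP conv"
  unfolding AP_iff_right_shift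
proof (rule totally_bounded_family_Lipschitz)
  show "totally_bounded_family (\<lambda>y. right_shift y f)" using assms by (simp add: AP_iff_right_shift)
  fix y z
  show "dist (right_shift y (left_shift x f)) (right_shift z (left_shift x f)) \<le> 1 * dist (right_shift y f) (right_shift z f)"
    using norm_left_shift_le[of x "right_shift y f - right_shift z f"] by (simp add: right_shift_left_shift_commute dist_norm left_shift_diff)
qed

lemma AP_right_shift:
  assumes "f \<in> AP conv"
  shows "right_shift x f \<in> AP conv"
  unfolding AP_iff_left_shift
proof (rule totally_bounded_family_Lipschitz)
  show "totally_bounded_family (\<lambda>y. left_shift y f)" using assms by (simp add: AP_iff_left_shift)
  fix y z
  show "dist (left_shift y (right_shift x f)) (left_shift z (right_shift x f)) \<le> 1 * dist (left_shift y f) (left_shift z f)"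
    using norm_right_shift_le[of x "left_shift y f - left_shift z f"] by (simp add: right_shift_left_shift_commute[symmetric] dist_norm right_shift_diff)
qed

lemma zero_AP: "0 \<in> AP conv"
proof -
  have "left_shift x 0 = 0" for x using left_shift_diff[of x 0 0] by simp
  then show ?thesis
    unfolding AP_iff_left_shift totally_bounded_family_def
    by (auto intro!: exI[of _ "{undefined}"])
qed

text \<open>
  The coefficient functions of \<open>finite_rank_approximation\<close> are bounded and continuous but need not
  be almost periodic; functionals on \<open>AP conv\<close> are extended in order to be applicable to them.
\<close>

lemma AP_dual_extension:
  assumes "\<mu> \<in> AP_dual conv"
  obtains m where "bounded_clinear_functional m" "\<And>g. g \<in> AP conv \<Longrightarrow> m g = \<mu> g"
proof -
  obtain B where B: "\<And>f. f \<in> AP conv \<Longrightarrow> cmod (\<mu> f) \<le> B * norm f"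
    using assms unfolding AP_dual_def by blast
  show ?thesis
  proof (rule complex_linear_extension[of "AP conv" \<mu> B])
    show "0 \<in> AP conv" by (rule zero_AP)
    show "\<mu> (f + g) = \<mu> f + \<mu> g" if "f \<in> AP conv" "g \<in> AP conv" for f g
      using assms that unfolding AP_dual_def by blast
    show "\<mu> (scaleC_bcontfun c f) = c * \<mu> f" if "f \<in> AP conv" for c f
      using assms that unfolding AP_dual_def by blast
  qed (use AP_add AP_scale B that in blast)+
qed

lemma Fubini_translates:
  assumes f: "f \<in> AP conv" and m: "bounded_clinear_functional m" and n: "bounded_clinear_functional n"
  shows "m (Bcontfun (\<lambda>x. n (left_shift x f))) = n (Bcontfun (\<lambda>y. m (right_shift y f)))"
  by (rule functional_Fubini[OF m n _ left_shift_right_shift norm_left_shift_le]) (use f in \<open>simp add: AP_iff_left_shift\<close>)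

lemma apply_functional_left_shift:
  assumes f: "f \<in> AP conv" and n: "bounded_clinear_functional n"
  shows "Bcontfun (\<lambda>x. n (left_shift x f)) x = n (left_shift x f)"
proof (rule apply_functional_family[OF n _ norm_left_shift_le])
  show "continuous_on UNIV (\<lambda>x. left_shift x f)"
    by (rule continuous_on_transpose[of "\<lambda>y. right_shift y f", OF _ left_shift_right_shift]) (use f in \<open>simp add: AP_iff_right_shift\<close>)
qed

text \<open>
  Integration against \<open>p\<^sub>x * p\<^sub>y\<close> is one of the two functionals when \<open>functional_Fubini\<close> is used to
  compute translates of \<open>T_op conv \<mu> f\<close> and \<open>U_op conv \<mu> f\<close>.
\<close>

lemma bounded_clinear_functional_eval_product:
  "bounded_clinear_functional (\<lambda>g. eval_product conv (apply_bcontfun g) x y)"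
  unfolding bounded_clinear_functional_def
proof (intro conjI allI)
  show "\<exists>B. \<forall>g :: 'k \<Rightarrow>\<^sub>C complex. cmod (eval_product conv (apply_bcontfun g) x y) \<le> B * norm g"
    by (rule exI[of _ 1]) (simp add: eval_product_le)
qed (simp_all add: eval_product_add eval_product_scale)

text \<open>
  In operator form this says that \<open>left_shift x\<close> commutes with \<open>T_op conv \<mu>\<close>.
\<close>

lemma left_shift_functional:
  assumes f: "f \<in> AP conv" and n: "bounded_clinear_functional n"
  shows "left_shift x (Bcontfun (\<lambda>w. n (left_shift w f))) y = n (left_shift y (left_shift x f))"
proof -
  have "(\<lambda>z. eval_product conv (right_shift z f) x y) = apply_bcontfun (left_shift y (left_shift x f))"
    by (rule ext) (simp add: eval_product_def left_shift_left_shift)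
  then show ?thesis
    using Fubini_translates[OF f bounded_clinear_functional_eval_product[of x y] n]
    by (simp add: apply_bcontfun_inverse apply_left_shift)
qed

lemma right_shift_functional:
  assumes f: "f \<in> AP conv" and n: "bounded_clinear_functional n"
  shows "right_shift y (Bcontfun (\<lambda>w. n (right_shift w f))) x = n (right_shift x (right_shift y f))"
proof -
  have "(\<lambda>z. eval_product conv (left_shift z f) x y) = apply_bcontfun (right_shift x (right_shift y f))"
  proof
    fix z
    show "eval_product conv (left_shift z f) x y = right_shift x (right_shift y f) z"
      using left_shift_left_shift[of x z f y] by (simp add: apply_left_shift apply_right_shift eval_product_def)
  qed
  then show ?thesis
    using Fubini_translates[OF f n bounded_clinear_functional_eval_product[of x y]]
    by (simp add: apply_bcontfun_inverse apply_right_shift)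
qed

text \<open>
  By \<open>left_shift_functional\<close> the left translates of the new function depend on those of \<open>f\<close> in a
  Lipschitz way.
\<close>

lemma AP_functional_left_shift:
  assumes f: "f \<in> AP conv" and n: "bounded_clinear_functional n"
  shows "Bcontfun (\<lambda>w. n (left_shift w f)) \<in> AP conv"
proof -
  obtain B where B: "0 \<le> B" "\<And>g. cmod (n g) \<le> B * norm g" by (rule functional_bound[OF n]) blast
  show ?thesis
    unfolding AP_iff_left_shift
  proof (rule totally_bounded_family_Lipschitz[where C = B])
    show "totally_bounded_family (\<lambda>x. left_shift x f)" using f by (simp add: AP_iff_left_shift)
    fix x z
    show "dist (left_shift x (Bcontfun (\<lambda>w. n (left_shift w f)))) (left_shift z (Bcontfun (\<lambda>w. n (left_shift w f)))) \<le> B * dist (left_shift x f) (left_shift z f)"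
    proof (rule dist_bound)
      fix y
      have "dist (left_shift x (Bcontfun (\<lambda>w. n (left_shift w f))) y) (left_shift z (Bcontfun (\<lambda>w. n (left_shift w f))) y)
          = cmod (n (left_shift y (left_shift x f - left_shift z f)))"
        by (simp add: left_shift_functional[OF f n] dist_norm functional_diff[OF n] left_shift_diff)
      also have "\<dots> \<le> B * norm (left_shift y (left_shift x f - left_shift z f))" by (rule B(2))
      also have "\<dots> \<le> B * dist (left_shift x f) (left_shift z f)"
        unfolding dist_norm by (intro mult_left_mono norm_left_shift_le B(1))
      finally show "dist (left_shift x (Bcontfun (\<lambda>w. n (left_shift w f))) y) (left_shift z (Bcontfun (\<lambda>w. n (left_shift w f))) y)
          \<le> B * dist (left_shift x f) (left_shift z f)" .
    qed
  qed
qed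

lemma AP_functional_right_shift:
  assumes f: "f \<in> AP conv" and n: "bounded_clinear_functional n"
  shows "Bcontfun (\<lambda>w. n (right_shift w f)) \<in> AP conv"
proof -
  obtain B where B: "0 \<le> B" "\<And>g. cmod (n g) \<le> B * norm g" by (rule functional_bound[OF n]) blast
  show ?thesis
    unfolding AP_iff_right_shift
  proof (rule totally_bounded_family_Lipschitz[where C = B])
    show "totally_bounded_family (\<lambda>x. right_shift x f)" using f by (simp add: AP_iff_right_shift)
    fix x z
    show "dist (right_shift x (Bcontfun (\<lambda>w. n (right_shift w f)))) (right_shift z (Bcontfun (\<lambda>w. n (right_shift w f)))) \<le> B * dist (right_shift x f) (right_shift z f)"
    proof (rule dist_bound)
      fix y
      have "dist (right_shift x (Bcontfun (\<lambda>w. n (right_shift w f))) y) (right_shift z (Bcontfun (\<lambda>w. n (right_shift w f))) y)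
          = cmod (n (right_shift y (right_shift x f - right_shift z f)))"
        by (simp add: right_shift_functional[OF f n] dist_norm functional_diff[OF n] right_shift_diff)
      also have "\<dots> \<le> B * norm (right_shift y (right_shift x f - right_shift z f))" by (rule B(2))
      also have "\<dots> \<le> B * dist (right_shift x f) (right_shift z f)"
        unfolding dist_norm by (intro mult_left_mono norm_right_shift_le B(1))
      finally show "dist (right_shift x (Bcontfun (\<lambda>w. n (right_shift w f))) y) (right_shift z (Bcontfun (\<lambda>w. n (right_shift w f))) y)
          \<le> B * dist (right_shift x f) (right_shift z f)" .
    qed
  qed
qed

lemma T_op_eq:
  assumes "f \<in> AP conv" "\<And>g. g \<in> AP conv \<Longrightarrow> m g = \<mu> g"
  shows "T_op conv \<mu> f = Bcontfun (\<lambda>x. m (left_shift x f))"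
  using assms by (simp add: T_op_def left_shift_def[symmetric] AP_left_shift)

lemma U_op_eq:
  assumes "f \<in> AP conv" "\<And>g. g \<in> AP conv \<Longrightarrow> m g = \<mu> g"
  shows "U_op conv \<mu> f = Bcontfun (\<lambda>x. m (right_shift x f))"
  using assms by (simp add: U_op_def right_shift_def[symmetric] AP_right_shift)

lemma
  assumes f: "f \<in> AP conv" and \<mu>: "\<mu> \<in> AP_dual conv"
  shows T_op_AP: "T_op conv \<mu> f \<in> AP conv"
    and apply_T_op: "T_op conv \<mu> f x = \<mu> (left_shift x f)"
proof -
  obtain m where m: "bounded_clinear_functional m" "\<And>g. g \<in> AP conv \<Longrightarrow> m g = \<mu> g"
    by (rule AP_dual_extension[OF \<mu>]) blast
  have T: "T_op conv \<mu> f = Bcontfun (\<lambda>x. m (left_shift x f))" by (rule T_op_eq[OF f m(2)])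
  show "T_op conv \<mu> f \<in> AP conv"
    unfolding T by (rule AP_functional_left_shift[OF f m(1)])
  show "T_op conv \<mu> f x = \<mu> (left_shift x f)"
    unfolding T apply_functional_left_shift[OF f m(1)] by (rule m(2)[OF AP_left_shift[OF f]])
qed

section \<open>The pairing of two functionals\<close>

lemma dual_pairing_swap:
  assumes f: "f \<in> AP conv" and \<mu>: "\<mu> \<in> AP_dual conv" and \<nu>: "\<nu> \<in> AP_dual conv"
  shows "\<mu> (T_op conv \<nu> f) = \<nu> (U_op conv \<mu> f)"
proof -
  obtain m where m: "bounded_clinear_functional m" "\<And>g. g \<in> AP conv \<Longrightarrow> m g = \<mu> g"
    by (rule AP_dual_extension[OF \<mu>]) blast
  obtain n where n: "bounded_clinear_functional n" "\<And>g. g \<in> AP conv \<Longrightarrow> n g = \<nu> g"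
    by (rule AP_dual_extension[OF \<nu>]) blast
  have T: "T_op conv \<nu> f = Bcontfun (\<lambda>x. n (left_shift x f))" by (rule T_op_eq[OF f n(2)])
  have U: "U_op conv \<mu> f = Bcontfun (\<lambda>y. m (right_shift y f))" by (rule U_op_eq[OF f m(2)])
  have "\<mu> (T_op conv \<nu> f) = m (Bcontfun (\<lambda>x. n (left_shift x f)))"
    unfolding T by (rule m(2)[symmetric]) (rule AP_functional_left_shift[OF f n(1)])
  also have "\<dots> = n (Bcontfun (\<lambda>y. m (right_shift y f)))" by (rule Fubini_translates[OF f m(1) n(1)])
  also have "\<dots> = \<nu> (U_op conv \<mu> f)"
    unfolding U by (rule n(2)) (rule AP_functional_right_shift[OF f m(1)])
  finally show ?thesis .
qed

lemma AP_dual_diff: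
  assumes "\<mu> \<in> AP_dual conv" "f \<in> AP conv" "g \<in> AP conv"
  shows "\<mu> (f - g) = \<mu> f - \<mu> g"
proof -
  have "\<mu> ((f - g) + g) = \<mu> (f - g) + \<mu> g"
    using assms(1) AP_diff[OF assms(2,3)] assms(3) unfolding AP_dual_def by blast
  then show ?thesis by simp
qed

lemma dual_ball_AP_dual: "\<mu> \<in> dual_ball conv \<Longrightarrow> \<mu> \<in> AP_dual conv"
  by (simp add: dual_ball_def)

text \<open>
  The supremum defining \<open>dual_norm\<close> is one over a set bounded above because \<open>\<mu>\<close> is bounded; the
  estimate then extends from the unit ball by homogeneity.
\<close>

lemma dual_ball_bound:
  assumes \<mu>: "\<mu> \<in> dual_ball conv" and f: "f \<in> AP conv"
  shows "cmod (\<mu> f) \<le> norm f"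
proof -
  obtain B where B: "\<And>g. g \<in> AP conv \<Longrightarrow> cmod (\<mu> g) \<le> B * norm g"
    using dual_ball_AP_dual[OF \<mu>] unfolding AP_dual_def by blast
  have unit: "cmod (\<mu> g) \<le> 1" if g: "g \<in> AP conv" "norm g \<le> 1" for g
  proof -
    have "bdd_above ((\<lambda>g. cmod (\<mu> g)) ` {g \<in> AP conv. norm g \<le> 1})"
    proof (rule bdd_aboveI2)
      fix h assume h: "h \<in> {g \<in> AP conv. norm g \<le> 1}"
      then have "cmod (\<mu> h) \<le> B * norm h" using B by simp
      also have "\<dots> \<le> \<bar>B\<bar> * norm h" by (intro mult_right_mono) auto
      also have "\<dots> \<le> \<bar>B\<bar> * 1" using h by (intro mult_left_mono) auto
      finally show "cmod (\<mu> h) \<le> \<bar>B\<bar> * 1" .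
    qed
    then have "cmod (\<mu> g) \<le> dual_norm conv \<mu>"
      unfolding dual_norm_def using g by (intro cSUP_upper) auto
    also have "\<dots> \<le> 1" using \<mu> by (simp add: dual_ball_def)
    finally show ?thesis .
  qed
  show ?thesis
  proof (cases "f = 0")
    case True
    then show ?thesis using B[OF f] by simp
  next
    case False
    let ?c = "complex_of_real (inverse (norm f))"
    have "norm (scaleC_bcontfun ?c f) \<le> 1" using False by (simp only: scaleC_bcontfun_of_real) simp
    then have "cmod (\<mu> (scaleC_bcontfun ?c f)) \<le> 1" by (intro unit AP_scale f)
    moreover have "\<mu> (scaleC_bcontfun ?c f) = ?c * \<mu> f"
      using dual_ball_AP_dual[OF \<mu>] f unfolding AP_dual_def by blast
    ultimately have "inverse (norm f) * cmod (\<mu> f) \<le> 1" by (simp add: norm_mult norm_inverse)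
    then show ?thesis using False by (simp add: field_simps)
  qed
qed

lemma topspace_weak_star_ball: "topspace (weak_star_ball conv) = dual_ball conv"
  by (auto simp: weak_star_ball_def dual_ball_def AP_dual_def PiE_def)

lemma continuous_map_evaluation:
  assumes "f \<in> AP conv"
  shows "continuous_map (weak_star_ball conv) euclidean (\<lambda>\<mu>. \<mu> f)"
  unfolding weak_star_ball_def
  by (intro continuous_map_from_subtopology continuous_map_product_projection assms)

text \<open>
  Functionals in the ball are \<open>1\<close>-Lipschitz, so those that are close on a finite net of the left
  translates of \<open>f\<close> are close on all of them. Thus \<open>\<nu> \<mapsto> T_op conv \<nu> f\<close> is continuous from the weak*
  topology to the norm, and the difference of two pairings splits into
  \<open>\<mu> (T_op conv \<nu> f - g)\<close> and \<open>\<mu> g - \<mu>\<^sub>0 g\<close> with \<open>g = T_op conv \<nu>\<^sub>0 f\<close>.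
\<close>

lemma pairing_jointly_continuous:
  assumes f: "f \<in> AP conv"
  shows "continuous_map (prod_topology (weak_star_ball conv) (weak_star_ball conv)) euclidean
           (\<lambda>(\<mu>, \<nu>). \<mu> (T_op conv \<nu> f))"
proof -
  let ?Z = "prod_topology (weak_star_ball conv) (weak_star_ball conv)"
  let ?\<Phi> = "\<lambda>p. fst p (T_op conv (snd p) f)"
  have topZ: "p \<in> topspace ?Z \<longleftrightarrow> fst p \<in> dual_ball conv \<and> snd p \<in> dual_ball conv" for p
    by (cases p) (simp add: topspace_weak_star_ball)
  have near: "\<exists>N. openin ?Z N \<and> p0 \<in> N \<and> (\<forall>p\<in>N. dist (?\<Phi> p) (?\<Phi> p0) < e)"
    if p0: "p0 \<in> topspace ?Z" and "0 < e" for p0 e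
  proof -
    define \<mu>0 \<nu>0 where "\<mu>0 = fst p0" and "\<nu>0 = snd p0"
    have \<mu>0: "\<mu>0 \<in> dual_ball conv" and \<nu>0: "\<nu>0 \<in> dual_ball conv"
      using p0 unfolding topZ by (simp_all add: \<mu>0_def \<nu>0_def)
    define g where "g = T_op conv \<nu>0 f"
    have g: "g \<in> AP conv" unfolding g_def by (rule T_op_AP[OF f dual_ball_AP_dual[OF \<nu>0]])
    have "totally_bounded_family (\<lambda>x. left_shift x f)" using f by (simp add: AP_iff_left_shift)
    moreover have "0 < e / 8" using \<open>0 < e\<close> by simp
    ultimately obtain X where X: "finite X" "\<And>x. \<exists>i\<in>X. dist (left_shift x f) (left_shift i f) < e / 8"
      by (rule totally_bounded_familyD) blast
    let ?A = "{p \<in> topspace ?Z. fst p g \<in> ball (\<mu>0 g) (e / 4)}"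
    let ?B = "\<lambda>i. {p \<in> topspace ?Z. snd p (left_shift i f) \<in> ball (\<nu>0 (left_shift i f)) (e / 4)}"
    let ?N = "?A \<inter> ((\<Inter>i\<in>X. ?B i) \<inter> topspace ?Z)"
    have "continuous_map ?Z euclidean (\<lambda>p. fst p g)"
      using continuous_map_compose[OF continuous_map_fst continuous_map_evaluation[OF g]]
      by (simp add: o_def)
    then have A: "openin ?Z ?A" by (rule openin_continuous_map_preimage) simp
    have "continuous_map ?Z euclidean (\<lambda>p. snd p (left_shift i f))" for i
      using continuous_map_compose[OF continuous_map_snd continuous_map_evaluation[OF AP_left_shift[OF f]]]
      by (simp add: o_def)
    then have B: "openin ?Z (?B i)" for i by (rule openin_continuous_map_preimage) simp
    have "openin ?Z ?N" by (intro openin_Int A openin_INT X(1) B)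
    moreover have "p0 \<in> ?N" using p0 \<open>0 < e\<close> by (simp add: \<mu>0_def \<nu>0_def)
    moreover have "dist (?\<Phi> p) (?\<Phi> p0) < e" if p: "p \<in> ?N" for p
    proof -
      define \<mu> \<nu> where "\<mu> = fst p" and "\<nu> = snd p"
      have "p \<in> topspace ?Z" using p by blast
      then have \<mu>: "\<mu> \<in> dual_ball conv" and \<nu>: "\<nu> \<in> dual_ball conv"
        unfolding topZ by (simp_all add: \<mu>_def \<nu>_def)
      have 1: "dist (\<mu> g) (\<mu>0 g) < e / 4" using p by (simp add: \<mu>_def dist_commute)
      have 2: "dist (\<nu> (left_shift i f)) (\<nu>0 (left_shift i f)) < e / 4" if "i \<in> X" for i
        using p that by (simp add: \<nu>_def dist_commute)
      have T: "T_op conv \<nu> f \<in> AP conv" by (rule T_op_AP[OF f dual_ball_AP_dual[OF \<nu>]])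
      have lip: "dist (\<rho> (left_shift x f)) (\<rho> (left_shift i f)) \<le> dist (left_shift x f) (left_shift i f)"
        if \<rho>: "\<rho> \<in> dual_ball conv" for \<rho> x i
        using dual_ball_bound[OF \<rho> AP_diff[OF AP_left_shift[OF f] AP_left_shift[OF f]], of x i]
        by (simp add: dist_norm AP_dual_diff[OF dual_ball_AP_dual[OF \<rho>] AP_left_shift[OF f] AP_left_shift[OF f]])
      have "dist (T_op conv \<nu> f) g \<le> e / 2"
      proof (rule dist_bound)
        fix x
        obtain i where i: "i \<in> X" "dist (left_shift x f) (left_shift i f) < e / 8" using X(2) by blast
        have "dist (\<nu> (left_shift x f)) (\<nu>0 (left_shift x f))
            \<le> dist (\<nu> (left_shift x f)) (\<nu> (left_shift i f)) + dist (\<nu> (left_shift i f)) (\<nu>0 (left_shift i f))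
              + dist (\<nu>0 (left_shift x f)) (\<nu>0 (left_shift i f))"
          using dist_triangle[of "\<nu> (left_shift x f)" "\<nu>0 (left_shift x f)" "\<nu> (left_shift i f)"]
            dist_triangle2[of "\<nu> (left_shift i f)" "\<nu>0 (left_shift x f)" "\<nu>0 (left_shift i f)"] by linarith
        also have "\<dots> \<le> e / 2"
          using lip[OF \<nu>, of x i] lip[OF \<nu>0, of x i] 2[OF i(1)] i(2) by linarith
        finally show "dist (T_op conv \<nu> f x) (g x) \<le> e / 2"
          by (simp add: g_def apply_T_op[OF f dual_ball_AP_dual[OF \<nu>]] apply_T_op[OF f dual_ball_AP_dual[OF \<nu>0]])
      qed
      moreover have "dist (\<mu> (T_op conv \<nu> f)) (\<mu> g) \<le> dist (T_op conv \<nu> f) g"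
        using dual_ball_bound[OF \<mu> AP_diff[OF T g]]
        by (simp add: dist_norm AP_dual_diff[OF dual_ball_AP_dual[OF \<mu>] T g])
      ultimately have "dist (\<mu> (T_op conv \<nu> f)) (\<mu>0 g) < e"
        using 1 \<open>0 < e\<close> dist_triangle[of "\<mu> (T_op conv \<nu> f)" "\<mu>0 g" "\<mu> g"] by linarith
      then show ?thesis by (simp add: \<mu>_def \<nu>_def \<mu>0_def \<nu>0_def g_def)
    qed
    ultimately show ?thesis by blast
  qed
  have "continuous_map ?Z euclidean ?\<Phi>"
    unfolding continuous_map_def
  proof (intro conjI allI impI)
    fix W :: "complex set" assume "openin euclidean W"
    then have W: "open W" by simp
    show "openin ?Z {p \<in> topspace ?Z. ?\<Phi> p \<in> W}"
    proof (subst openin_subopen, intro ballI)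
      fix p0 assume p0: "p0 \<in> {p \<in> topspace ?Z. ?\<Phi> p \<in> W}"
      then have "?\<Phi> p0 \<in> W" by simp
      from bspec[OF W[unfolded open_dist] this] obtain e where
        e: "0 < e" "\<forall>y. dist y (?\<Phi> p0) < e \<longrightarrow> y \<in> W" by (elim exE conjE)
      have "p0 \<in> topspace ?Z" using p0 by blast
      from near[OF this e(1)] obtain N where
        N: "openin ?Z N" "p0 \<in> N" "\<forall>p\<in>N. dist (?\<Phi> p) (?\<Phi> p0) < e" by (elim exE conjE)
      have "N \<subseteq> {p \<in> topspace ?Z. ?\<Phi> p \<in> W}"
        using openin_subset[OF N(1)] N(3) e(2) by blast
      then show "\<exists>T. openin ?Z T \<and> p0 \<in> T \<and> T \<subseteq> {p \<in> topspace ?Z. ?\<Phi> p \<in> W}"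
        using N(1,2) by blast
    qed
  qed simp
  then show ?thesis by (simp add: case_prod_unfold)
qed

end

theorem theorem4p19:
  fixes conv :: "'k::t2_space convolution"
    and f :: "'k \<Rightarrow>\<^sub>C complex"
  assumes "semitopological_semihypergroup conv"
    and "f \<in> AP conv"
  shows "continuous_map (prod_topology (weak_star_ball conv) (weak_star_ball conv)) euclidean
           (\<lambda>(\<mu>, \<nu>). \<mu> (T_op conv \<nu> f)) \<and>
         (\<forall>\<mu> \<in> AP_dual conv. \<forall>\<nu> \<in> AP_dual conv. \<mu> (T_op conv \<nu> f) = \<nu> (U_op conv \<mu> f))"
proof -
  interpret semitopological_semihypergroup conv by fact
  show ?thesis
    using pairing_jointly_continuous[OF assms(2)] dual_pairing_swap[OF assms(2)] by blast
qed

end
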